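(* Let $\Omega\subseteq\mathbb C$ be a semialgebraic set which is open in its closure. Let $b_s$ be the number of connected components of $\Omega$, $b_{ss}$ the number of connected components of the border $\overline\Omega\setminus\Omega$, and $b_{un}$ the number of connected components of $\mathbb C\setminus\overline\Omega$. Let $k,l,m$ be nonnegative integers. Then the space of complex polynomials of degree $k+l+m$ having (counted with multiplicity) $k$ roots in $\Omega$, $l$ roots in $\overline\Omega\setminus\Omega$ and $m$ roots in $\mathbb C\setminus\overline\Omega$ has exactly $$\binom{b_s+k-1}{k}\binom{b_{ss}+l-1}{l}\binom{b_{un}+m-1}{m}$$ connected components.
   Context: Closures are in the Euclidean topology of $\mathbb C\cong\mathbb R^2$; semialgebraic means semialgebraic in $\mathbb R^2$. The space of polynomials carries the Euclidean topology on coefficients. Convention: $\binom{b+k-1}{k}$ is the number of multisets of cardinality $k$ from a $b$-element set; thus it is $1$ if $k=0$ and $0$ if $b=0<k$. *)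

theory Defs
  imports
    "HOL-Analysis.Analysis"
    "HOL-Computational_Algebra.Polynomial"
begin

text \<open>Identifying the complex plane with the real plane, a bivariate real polynomial is an element of
  \<^typ>\<open>real poly poly\<close>: the outer indeterminate is evaluated at the real part and
  the inner one at the imaginary part.\<close>

inductive semialgebraic :: "complex set \<Rightarrow> bool" where
  pos: "semialgebraic {z. poly (poly P [:Re z:]) (Im z) > 0}" for P :: "real poly poly"
| Un: "semialgebraic A \<Longrightarrow> semialgebraic B \<Longrightarrow> semialgebraic (A \<union> B)"
| Compl: "semialgebraic A \<Longrightarrow> semialgebraic (- A)"

text \<open>The coefficients of a polynomial of degree at most \<open>n\<close> vanish beyond index \<open>n\<close>, so the
  product topology on coefficient sequences induces the Euclidean topology on
  the remaining \<open>n + 1\<close> coefficients; see \<open>openin_poly_topology\<close>.\<close>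

definition poly_topology :: "nat \<Rightarrow> complex poly topology" where
  "poly_topology n = pullback_topology {p. degree p \<le> n} coeff euclidean"

lemma topspace_poly_topology [simp]: "topspace (poly_topology n) = {p. degree p \<le> n}"
  by (simp add: poly_topology_def topspace_pullback_topology)

lemma openin_poly_topology:
  "openin (poly_topology n) U \<longleftrightarrow>
     U \<subseteq> {p. degree p \<le> n} \<and>
     (\<forall>p\<in>U. \<exists>e>0. \<forall>q. degree q \<le> n \<and> (\<forall>i\<le>n. dist (coeff q i) (coeff p i) < e) \<longrightarrow> q \<in> U)"
  (is "?L \<longleftrightarrow> ?R")
proof
  assume ?L
  then have "\<exists>V. openin euclidean V \<and> U = coeff -` V \<inter> {p. degree p \<le> n}"
    by (simp only: poly_topology_def openin_pullback_topology)
  then obtain V where V: "open V" "U = coeff -` V \<inter> {p. degree p \<le> n}"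
    by (auto simp only: open_openin[symmetric])
  have "\<exists>e>0. \<forall>q. degree q \<le> n \<and> (\<forall>i\<le>n. dist (coeff q i) (coeff p i) < e) \<longrightarrow> q \<in> U"
    if pU: "p \<in> U" for p
  proof -
    have "openin (product_topology (\<lambda>_. euclidean) UNIV) V"
      using V(1) by (simp only: euclidean_product_topology open_openin[symmetric])
    moreover have "coeff p \<in> V" using pU V by auto
    ultimately obtain X where X: "coeff p \<in> (\<Pi>\<^sub>E i\<in>UNIV. X i)" "\<And>i. open (X i)"
      "(\<Pi>\<^sub>E i\<in>UNIV. X i) \<subseteq> V"
      using product_topology_open_contains_basis[of "\<lambda>_. euclidean" UNIV V "coeff p"]
      by (metis open_openin)
    have "\<forall>i. \<exists>e>0. ball (coeff p i) e \<subseteq> X i"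
      using X(1,2) by (auto simp: PiE_iff open_contains_ball)
    then obtain e where e: "\<And>i. e i > 0" "\<And>i. ball (coeff p i) (e i) \<subseteq> X i" by metis
    define d where "d = Min (e ` {..n})"
    have d: "d > 0" "\<And>i. i \<le> n \<Longrightarrow> d \<le> e i" using e(1) by (auto simp: d_def)
    have "q \<in> U" if q: "degree q \<le> n" "\<forall>i\<le>n. dist (coeff q i) (coeff p i) < d" for q
    proof -
      have "coeff q i \<in> X i" for i
      proof (cases "i \<le> n")
        case True
        then have "dist (coeff p i) (coeff q i) < e i"
          using q(2) d(2)[of i] by (force simp: dist_commute)
        then show ?thesis using e(2)[of i] by (auto simp: subset_iff)
      next
        case False
        then have "coeff q i = coeff p i"
          using q(1) pU V(2) by (simp add: coeff_eq_0)
        then show ?thesis using X(1) by (auto simp: PiE_iff)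
      qed
      then show ?thesis using X(3) V(2) q(1) by auto
    qed
    then show ?thesis using d(1) by blast
  qed
  then show ?R using V(2) by auto
next
  assume R: ?R
  have "\<exists>T. openin (poly_topology n) T \<and> p \<in> T \<and> T \<subseteq> U" if pU: "p \<in> U" for p
  proof -
    obtain e where e: "e > 0"
      "\<forall>q. degree q \<le> n \<and> (\<forall>i\<le>n. dist (coeff q i) (coeff p i) < e) \<longrightarrow> q \<in> U"
      using bspec[OF conjunct2[OF R] pU] by (elim exE conjE)
    define V where "V = (\<Inter>i\<in>{..n}. {f. dist (f i) (coeff p i) < e})"
    have "open V" unfolding V_def
      by (intro open_INT ballI finite_atMost open_Collect_less continuous_intros) auto
    then have "openin (poly_topology n) (coeff -` V \<inter> {q. degree q \<le> n})"
      unfolding poly_topology_def openin_pullback_topology open_openin[symmetric]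
      by (intro exI[of _ V] conjI refl)
    moreover have "p \<in> coeff -` V \<inter> {q. degree q \<le> n}"
      using R pU e(1) by (auto simp: V_def)
    moreover have "coeff -` V \<inter> {q. degree q \<le> n} \<subseteq> U"
      using e(2) by (auto simp: V_def)
    ultimately show ?thesis by blast
  qed
  then show ?L by (subst openin_subopen) blast
qed

text \<open>The zero polynomial is excluded explicitly because \<^prop>\<open>degree 0 = 0\<close>.\<close>

definition root_stratum :: "complex set \<Rightarrow> nat \<Rightarrow> nat \<Rightarrow> nat \<Rightarrow> complex poly set" where
  "root_stratum \<Omega> k l m =
     {p. p \<noteq> 0 \<and> degree p = k + l + m \<and>
         size (filter_mset (\<lambda>z. z \<in> \<Omega>) (proots p)) = k \<and>
         size (filter_mset (\<lambda>z. z \<in> closure \<Omega> - \<Omega>) (proots p)) = l \<and>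
         size (filter_mset (\<lambda>z. z \<in> - closure \<Omega>) (proots p)) = m}"

end

theory Submission
  imports Defs
    "HOL-Computational_Algebra.Fundamental_Theorem_Algebra"
    "HOL-Computational_Algebra.Polynomial_Factorial"
    "HOL-Computational_Algebra.Field_as_Ring"
begin

text \<open>
  The space of polynomials in question is fibred over the multisets of their roots. If each
  root is confined to a connected component of \<open>\<Omega>\<close>, of the border or of the exterior, the
  polynomials with such roots form a connected set, as a continuous image of a product of
  connected sets (the leading coefficient ranges over the connected punctured plane). So the
  number of components is at most the number of ways of distributing the roots over
  the components, and this number is the stated product of multiset counts.

  Different distributions cannot be joined. Roots depend continuously on the polynomial
  (\<open>roots_converge\<close>), so it suffices that under a small perturbation inside the stratum no root
  leaves its component. A root in the exterior remains in the exterior; a root in \<open>\<Omega>\<close> can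
  leave its component only for the exterior, because \<open>\<Omega>\<close> is open in its closure; a root in the border could
  go anywhere. Giving the exterior, \<open>\<Omega>\<close> and the border the weights \<open>0\<close>, \<open>1\<close>, \<open>2\<close>, the
  weight of a root never increases, whereas the total weight \<open>k + 2 * l\<close> is constant on the stratum.
  Hence every root keeps its weight, and then its component, provided components are open in the
  respective set (\<open>components_of_labelled_strata\<close>, \<open>root_stratum_components\<close>).

  The last proviso, as well as the meaning of the formula, rests on the finiteness of the numbers of
  components (\<open>semialgebraic_finite_components\<close>). It is obtained from a cylindrical decomposition
  of the plane. Let \<open>F\<close> be the product of the prime factors of all polynomials that define
  \<open>\<Omega>\<close>. Outside finitely many heights \<open>y\<close> the restriction of \<open>F\<close> to the horizontal
  line at height \<open>y\<close> has constant degree and simple roots (\<open>squarefree_fibres\<close>). Between two exceptional heights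
  the real roots are therefore disjoint graphs of continuous functions of \<open>y\<close>
  (\<open>real_roots_locally_continuous\<close>), which cut the strip into finitely many connected cells
  on which all signs are constant (\<open>sign_invariant_graph_systems\<close>). In the strip, the closure of a
  union of cells is a union of cells (\<open>closure_cell\<close>). On an exceptional line a connectedness argument
  takes the place of limits of the graphs: it shows that the closure of a cell meets the line in an interval (\<open>interval_cluster_set\<close>). Consequently \<open>\<Omega>\<close>,
  its border and its exterior are finite unions of connected sets.
\<close>

section \<open>Continuity of the roots of a complex polynomial\<close>

lemma coeff_synthetic_div:
  "coeff (synthetic_div p w) i = coeff p (Suc i) + w * coeff (synthetic_div p w) (Suc i)"
proof -
  have "coeff (p + smult w (synthetic_div p w)) (Suc i) = coeff (pCons (poly p w) (synthetic_div p w)) (Suc i)"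
    by (simp only: synthetic_div_correct)
  then show ?thesis by simp
qed

lemma tendsto_poly:
  fixes q :: "'t \<Rightarrow> complex poly"
  assumes "\<forall>\<^sub>F t in F. degree (q t) \<le> n" "degree p \<le> n"
    and "\<And>i. ((\<lambda>t. coeff (q t) i) \<longlongrightarrow> coeff p i) F"
  shows "((\<lambda>t. poly (q t) z) \<longlongrightarrow> poly p z) F"
proof -
  have *: "poly r z = (\<Sum>i\<le>n. coeff r i * z ^ i)" if "degree r \<le> n" for r
    unfolding poly_altdef using that by (intro sum.mono_neutral_left) (auto simp: coeff_eq_0)
  have "((\<lambda>t. \<Sum>i\<le>n. coeff (q t) i * z ^ i) \<longlongrightarrow> (\<Sum>i\<le>n. coeff p i * z ^ i)) F"
    by (intro tendsto_sum tendsto_mult assms tendsto_const)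
  then have "((\<lambda>t. \<Sum>i\<le>n. coeff (q t) i * z ^ i) \<longlongrightarrow> poly p z) F"
    using *[OF assms(2)] by simp
  then show ?thesis
    by (rule Lim_transform_eventually) (use assms(1) in eventually_elim, simp add: *)
qed

text \<open>In modulus, the value at \<open>z\<close> is the leading coefficient times the product of the distances
  from \<open>z\<close> to the roots, and the closest root has the smallest of these factors.\<close>

lemma exists_root_near:
  fixes p :: "complex poly"
  assumes "degree p > 0"
  shows "\<exists>w. poly p w = 0 \<and> norm (lead_coeff p) * norm (z - w) ^ degree p \<le> norm (poly p z)"
proof -
  have p0: "p \<noteq> 0" using assms by auto
  have "set_mset (proots p) \<noteq> {}"
    using assms size_proots_complex[of p] by auto
  moreover have "finite (set_mset (proots p))" by simp
  ultimately obtain w where w: "w \<in># proots p" "\<And>v. v \<in># proots p \<Longrightarrow> norm (z - w) \<le> norm (z - v)"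
    using ex_is_arg_min_if_finite[of "set_mset (proots p)" "\<lambda>v. norm (z - v)"]
    by (auto simp: is_arg_min_linorder)
  have "norm (z - w) ^ size M \<le> norm (\<Prod>x\<in>#M. z - x)" if "M \<subseteq># proots p" for M
    using that
  proof (induction M)
    case (add x M)
    have "x \<in># proots p" using add.prems by (meson insert_subset_eq_iff)
    moreover have "M \<subseteq># proots p" using add.prems by (meson mset_subset_eq_insertD subset_mset.less_imp_le)
    ultimately show ?case using add.IH w(2)[of x]
      by (simp add: norm_mult mult_mono)
  qed simp
  from this[of "proots p"] have "norm (z - w) ^ degree p \<le> norm (\<Prod>x\<in>#proots p. z - x)"
    by (simp add: size_proots_complex)
  moreover have "poly p z = lead_coeff p * (\<Prod>x\<in>#proots p. z - x)"
    by (subst (1) complex_poly_decompose_multiset[symmetric])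
       (simp add: poly_prod_mset image_mset.compositionality o_def)
  ultimately show ?thesis using w(1) p0
    by (intro exI[of _ w]) (auto simp: norm_mult intro!: mult_left_mono)
qed

text \<open>The roots of a polynomial of constant degree depend continuously on its coefficients, in the
  sense that convergence of the coefficients lets the roots be listed so that every entry of the
  list converges. One root is split off at a time: a root of \<open>q t\<close> nearest to \<open>z\<close> tends to
  \<open>z\<close> because \<open>q t\<close> takes values tending to \<open>0\<close> at \<open>z\<close>, and the coefficients of the quotient
  by the corresponding linear factor converge again. A general filter is used because one
  application lets polynomials converge along a sequence and another along a real parameter.\<close>

lemma roots_converge:
  fixes q :: "'t \<Rightarrow> complex poly"
  assumes "\<forall>\<^sub>F t in F. degree (q t) = length zs" and "c \<noteq> 0"
    and "\<And>i. ((\<lambda>t. coeff (q t) i) \<longlongrightarrow> coeff (smult c (\<Prod>z\<leftarrow>zs. [:-z, 1:])) i) F"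
  shows "\<exists>ws. (\<forall>t. length (ws t) = length zs) \<and> (\<forall>\<^sub>F t in F. mset (ws t) = proots (q t)) \<and>
              (\<forall>i<length zs. ((\<lambda>t. ws t ! i) \<longlongrightarrow> zs ! i) F)"
  using assms(1,3)
proof (induction zs arbitrary: q)
  case Nil
  have "\<forall>\<^sub>F t in F. mset [] = proots (q t)"
    using Nil.prems(1) by eventually_elim (auto elim: degree_eq_zeroE)
  then show ?case by (intro exI[of _ "\<lambda>_. []"]) auto
next
  case (Cons z zs)
  define n where "n = length (z # zs)"
  have n: "n > 0" by (simp add: n_def)
  define P where "P = smult c (\<Prod>z\<leftarrow>z # zs. [:-z, 1:])"
  define Q where "Q = smult c (\<Prod>z\<leftarrow>zs. [:-z, 1:])"
  have degprod: "degree (\<Prod>z\<leftarrow>ys. [:-z, 1:]) = length ys \<and> lead_coeff (\<Prod>z\<leftarrow>ys. [:-z, 1::complex:]) = 1" for ys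
  proof (induction ys)
    case (Cons a ys)
    then have "(\<Prod>z\<leftarrow>ys. [:-z, 1:]) \<noteq> 0" by auto
    moreover have "lead_coeff ([:-a, 1:] * (\<Prod>z\<leftarrow>ys. [:-z, 1:])) = 1"
      by (subst lead_coeff_mult) (use Cons in auto)
    ultimately show ?case using Cons by (simp add: degree_mult_eq del: mult_pCons_left)
  qed simp
  have PQ: "P = [:-z, 1:] * Q" by (simp add: P_def Q_def del: mult_pCons_left)
  have degP: "degree P = n" and lcP: "coeff P n = c"
    using degprod[of "z # zs"] \<open>c \<noteq> 0\<close> by (auto simp: P_def n_def del: mult_pCons_left)
  have degQ: "degree Q = length zs" using degprod[of zs] \<open>c \<noteq> 0\<close> by (auto simp: Q_def)
  have deg: "\<forall>\<^sub>F t in F. degree (q t) = n" using Cons.prems(1) by (simp add: n_def)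
  have lim: "((\<lambda>t. coeff (q t) i) \<longlongrightarrow> coeff P i) F" for i
    using Cons.prems(2)[of i] by (simp only: P_def)
  have "\<exists>w. degree (q t) = n \<longrightarrow>
      poly (q t) w = 0 \<and> norm (coeff (q t) n) * norm (z - w) ^ n \<le> norm (poly (q t) z)" for t
    using exists_root_near[of "q t" z] n by (cases "degree (q t) = n") auto
  then obtain w where w: "\<And>t. degree (q t) = n \<Longrightarrow>
      poly (q t) (w t) = 0 \<and> norm (coeff (q t) n) * norm (z - w t) ^ n \<le> norm (poly (q t) z)" by metis
  have "poly P z = 0" by (simp add: PQ)
  moreover have "((\<lambda>t. poly (q t) z) \<longlongrightarrow> poly P z) F"
    by (rule tendsto_poly[where n = n]) (use deg lim degP in \<open>auto elim: eventually_mono\<close>)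
  ultimately have "((\<lambda>t. root n (norm (poly (q t) z) / norm (coeff (q t) n))) \<longlongrightarrow>
      root n (norm (0::complex) / norm c)) F"
    using lim[of n] \<open>c \<noteq> 0\<close> unfolding lcP
    by (intro tendsto_real_root tendsto_divide tendsto_norm) auto
  then have lim0: "((\<lambda>t. root n (norm (poly (q t) z) / norm (coeff (q t) n))) \<longlongrightarrow> 0) F" by simp
  have cn: "\<forall>\<^sub>F t in F. coeff (q t) n \<noteq> 0"
    using lim[of n] \<open>c \<noteq> 0\<close> unfolding lcP by (rule tendsto_imp_eventually_ne)
  have "((\<lambda>t. w t - z) \<longlongrightarrow> 0) F"
  proof (rule Lim_null_comparison[OF _ lim0])
    show "\<forall>\<^sub>F t in F. norm (w t - z) \<le> root n (norm (poly (q t) z) / norm (coeff (q t) n))"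
      using deg cn
    proof eventually_elim
      case (elim t)
      have "norm (w t - z) = root n (norm (z - w t) ^ n)"
        using n by (simp add: real_root_power_cancel norm_minus_commute)
      also have "\<dots> \<le> root n (norm (poly (q t) z) / norm (coeff (q t) n))"
        using w[of t] elim n by (intro real_root_le_mono) (auto simp: field_simps)
      finally show ?case .
    qed
  qed
  then have limw: "(w \<longlongrightarrow> z) F" by (rule LIM_zero_cancel)
  define q' where "q' = (\<lambda>t. synthetic_div (q t) (w t))"
  have deg': "\<forall>\<^sub>F t in F. degree (q' t) = length zs"
    using deg by eventually_elim (simp add: q'_def degree_synthetic_div n_def)
  have cQ: "coeff Q i = coeff P (Suc i) + z * coeff Q (Suc i)" for i
    unfolding PQ by simp
  \<comment> \<open>Horner's scheme computes the coefficients of the quotient downwards from the leading one.\<close>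
  have lim': "((\<lambda>t. coeff (q' t) i) \<longlongrightarrow> coeff Q i) F" for i
  proof -
    have big: "((\<lambda>t. coeff (q' t) i) \<longlongrightarrow> coeff Q i) F" if "i \<ge> n" for i
    proof (rule tendsto_eventually)
      show "\<forall>\<^sub>F t in F. coeff (q' t) i = coeff Q i"
        using deg' by eventually_elim (use that degQ n_def in \<open>simp add: coeff_eq_0\<close>)
    qed
    show ?thesis
    proof (cases "i \<le> n")
      case True
      then show ?thesis
      proof (induction i rule: inc_induct)
        case (step i)
        have "((\<lambda>t. coeff (q t) (Suc i) + w t * coeff (q' t) (Suc i)) \<longlongrightarrow>
               coeff P (Suc i) + z * coeff Q (Suc i)) F"
          by (intro tendsto_intros lim limw step.IH)
        then show ?case unfolding q'_def by (subst coeff_synthetic_div, subst cQ)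
      qed (rule big, simp)
    qed (use big in auto)
  qed
  from Cons.IH[OF deg' lim'[unfolded Q_def]] obtain ws where ws: "\<And>t. length (ws t) = length zs"
    "\<forall>\<^sub>F t in F. mset (ws t) = proots (q' t)" "\<And>i. i < length zs \<Longrightarrow> ((\<lambda>t. ws t ! i) \<longlongrightarrow> zs ! i) F"
    by auto
  have "\<forall>\<^sub>F t in F. mset (w t # ws t) = proots (q t)"
    using deg ws(2)
  proof eventually_elim
    case (elim t)
    have "q t = [:- w t, 1:] * q' t"
      using synthetic_div_correct'[of "w t" "q t"] w[of t] elim by (simp add: q'_def del: mult_pCons_left)
    moreover have "q t \<noteq> 0" using elim n by auto
    ultimately have "proots (q t) = proots [:- w t, 1:] + proots (q' t)"
      by (metis mult_eq_0_iff proots_mult)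
    then show ?case using elim by simp
  qed
  moreover have "((\<lambda>t. (w t # ws t) ! i) \<longlongrightarrow> (z # zs) ! i) F" if "i < length (z # zs)" for i
    using that ws(3) limw by (cases i) auto
  ultimately show ?case using ws(1) by (intro exI[of _ "\<lambda>t. w t # ws t"]) auto
qed

text \<open>The pointwise form of root continuity: since membership in an open set of polynomials is
  tested by one \<open>e\<close> for all coefficients, a failure for every \<open>e\<close> yields a sequence that
  contradicts the convergence of the roots.\<close>

lemma roots_close:
  fixes p :: "complex poly"
  assumes "p \<noteq> 0" "degree p = n" "mset zs = proots p" and ev: "\<And>i. i < n \<Longrightarrow> \<forall>\<^sub>F w in nhds (zs ! i). R i w"
  shows "\<exists>e>0. \<forall>q. degree q = n \<and> (\<forall>i\<le>n. dist (coeff q i) (coeff p i) < e) \<longrightarrow>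
           (\<exists>ws. length ws = n \<and> mset ws = proots q \<and> (\<forall>i<n. R i (ws ! i)))"
proof (rule ccontr)
  assume neg: "\<not> ?thesis"
  have "\<exists>q. degree q = n \<and> (\<forall>i\<le>n. dist (coeff q i) (coeff p i) < 1 / real (Suc k)) \<and>
      \<not> (\<exists>ws. length ws = n \<and> mset ws = proots q \<and> (\<forall>i<n. R i (ws ! i)))" for k
    using neg[simplified, rule_format, of "1 / real (Suc k)"] by auto
  then obtain q where q: "\<And>k. degree (q k) = n"
      "\<And>k i. i \<le> n \<Longrightarrow> dist (coeff (q k) i) (coeff p i) < 1 / real (Suc k)"
      "\<And>k. \<not> (\<exists>ws. length ws = n \<and> mset ws = proots (q k) \<and> (\<forall>i<n. R i (ws ! i)))"
    by metis
  have len: "length zs = n"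
    using assms(2,3) by (metis size_mset size_proots_complex)
  have p: "p = smult (lead_coeff p) (\<Prod>z\<leftarrow>zs. [:-z, 1:])"
    by (subst (1) complex_poly_decompose_multiset[symmetric])
       (simp flip: assms(3) add: prod_mset_prod_list flip: mset_map)
  have lim: "(\<lambda>k. coeff (q k) i) \<longlonglongrightarrow> coeff p i" for i
  proof (cases "i \<le> n")
    case True
    have "\<forall>\<^sub>F k in sequentially. dist (coeff (q k) i) (coeff p i) \<le> inverse (real (Suc k))"
      using q(2)[OF True] by (intro always_eventually allI less_imp_le) (simp add: divide_inverse)
    from tendsto_0_le[OF LIMSEQ_inverse_real_of_nat, of "\<lambda>k. dist (coeff (q k) i) (coeff p i)" 1]
    show ?thesis using q(2)[OF True]
      by (subst tendsto_dist_iff) (auto simp: divide_inverse intro!: always_eventually less_imp_le)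
  next
    case False
    then show ?thesis using q(1) assms(2) by (simp add: coeff_eq_0)
  qed
  have "\<exists>ws. (\<forall>t. length (ws t) = length zs) \<and> (\<forall>\<^sub>F t in sequentially. mset (ws t) = proots (q t)) \<and>
              (\<forall>i<length zs. ((\<lambda>t. ws t ! i) \<longlongrightarrow> zs ! i) sequentially)"
    by (rule roots_converge[where c = "lead_coeff p"]) (use q(1) len lim p assms(1) in auto)
  then obtain ws where ws: "\<And>k. length (ws k) = n" "\<forall>\<^sub>F k in sequentially. mset (ws k) = proots (q k)"
    "\<And>i. i < n \<Longrightarrow> (\<lambda>k. ws k ! i) \<longlonglongrightarrow> zs ! i" unfolding len by auto
  have "\<forall>\<^sub>F k in sequentially. R i (ws k ! i)" if "i < n" for i
    by (rule eventually_compose_filterlim[OF ev[OF that] ws(3)[OF that]])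
  then have "\<forall>\<^sub>F k in sequentially. \<forall>i\<in>{..<n}. R i (ws k ! i)"
    by (subst eventually_ball_finite_distrib) auto
  with ws(2) have "\<forall>\<^sub>F k in sequentially. mset (ws k) = proots (q k) \<and> (\<forall>i\<in>{..<n}. R i (ws k ! i))"
    by (rule eventually_conj)
  then obtain k where "mset (ws k) = proots (q k)" "\<forall>i\<in>{..<n}. R i (ws k ! i)"
    by (auto dest!: eventually_happens)
  then show False using q(3)[of k] ws(1)[of k] by auto
qed

section \<open>Polynomials with prescribed labels of their roots\<close>

lemma connected_components_of_open_partition:
  assumes "\<And>C. C \<in> \<N> \<Longrightarrow> openin X C" "\<And>C. C \<in> \<N> \<Longrightarrow> connectedin X C" "{} \<notin> \<N>"
    and "pairwise disjnt \<N>" "\<Union>\<N> = topspace X"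
  shows "connected_components_of X = \<N>"
proof -
  have eq: "connected_component_of_set X x = C" if "C \<in> \<N>" "x \<in> C" for C x
  proof
    have "topspace X - C = \<Union>(\<N> - {C})"
      using assms(4,5) that(1) by (auto simp: pairwise_def disjnt_iff)
    then have "closedin X C"
      using assms(1,5) that(1) by (auto simp: closedin_def)
    moreover have "connectedin X (connected_component_of_set X x)"
      by (rule connectedin_connected_component_of)
    moreover have "x \<in> connected_component_of_set X x"
      using that assms(5) by (auto simp: connected_component_of_refl)
    ultimately show "connected_component_of_set X x \<subseteq> C"
      using connectedin_clopen_cases[of X "connected_component_of_set X x" C] assms(1)[OF that(1)] that(2)
      by (auto simp: disjnt_iff)
    show "C \<subseteq> connected_component_of_set X x"
      using that assms(2) by (intro connected_component_of_maximal)
  qed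
  show ?thesis
  proof (intro equalityI subsetI)
    fix D assume "D \<in> connected_components_of X"
    then obtain x where "x \<in> topspace X" "D = connected_component_of_set X x"
      by (auto simp: connected_components_of_def)
    then show "D \<in> \<N>" using eq assms(5) by (metis UnionE)
  next
    fix C assume C: "C \<in> \<N>"
    then obtain x where "x \<in> C" using assms(3) by fastforce
    then show "C \<in> connected_components_of X"
      using eq[OF C] assms(5) C unfolding connected_components_of_def by blast
  qed
qed

lemma proots_prod_linear: "proots (\<Prod>z\<leftarrow>zs. [:-z, 1::complex:]) = mset zs"
proof (induction zs)
  case (Cons a zs)
  have "(\<Prod>z\<leftarrow>zs. [:-z, 1::complex:]) \<noteq> 0"
    by (subst prod_list_zero_iff) auto
  then have "proots ([:-a, 1:] * (\<Prod>z\<leftarrow>zs. [:-z, 1::complex:])) = {#a#} + mset zs"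
    by (subst proots_mult) (use Cons in auto)
  then show ?case by simp
qed simp

lemma degree_prod_linear: "degree (\<Prod>z\<leftarrow>zs. [:-z, 1::complex:]) = length zs"
  by (metis proots_prod_linear size_mset size_proots_complex)

lemma image_mset_eq_mset_lift:
  "image_mset f M = mset ys \<Longrightarrow> \<exists>xs. mset xs = M \<and> map f xs = ys"
proof (induction ys arbitrary: M)
  case (Cons y ys)
  then obtain N x where N: "M = add_mset x N" "f x = y" "image_mset f N = mset ys"
    using msed_map_invR[of f M y "mset ys"] by auto
  from Cons.IH[OF N(3)] obtain xs where "mset xs = N" "map f xs = ys" by blast
  then show ?case using N by (intro exI[of _ "x # xs"]) auto
qed simp

definition labelled_roots :: "nat \<Rightarrow> (complex \<Rightarrow> 'b) \<Rightarrow> 'b multiset \<Rightarrow> complex poly set" where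
  "labelled_roots n lab \<nu> = {p. p \<noteq> 0 \<and> degree p = n \<and> image_mset lab (proots p) = \<nu>}"

text \<open>Listing the roots turns the multiset condition into a product of independent conditions;
  coordinate \<open>n\<close> of the parameter carries the leading coefficient, which ranges over the
  nonzero numbers.\<close>

lemma labelled_roots_eq_image:
  assumes "length Ds = n"
  shows "labelled_roots n lab (mset Ds) =
    (\<lambda>f. smult (f n) (\<Prod>i\<leftarrow>[0..<n]. [:- f i, 1:])) `
      (\<Pi>\<^sub>E i\<in>UNIV. if i < n then lab -` {Ds ! i} else - {0})" (is "?N = ?\<Phi> ` ?S")
proof (intro equalityI subsetI)
  fix p assume p: "p \<in> ?N"
  then obtain zs where zs: "mset zs = proots p" "map lab zs = Ds"
    using image_mset_eq_mset_lift[of lab "proots p" Ds] by (auto simp: labelled_roots_def)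
  have len: "length zs = n" using zs(2) assms by auto
  define f where "f = (\<lambda>i. if i < n then zs ! i else lead_coeff p)"
  have "map (\<lambda>i. [:- f i, 1:]) [0..<n] = map (\<lambda>z. [:- z, 1:]) zs"
    by (rule nth_equalityI) (auto simp: len f_def)
  then have "?\<Phi> f = smult (lead_coeff p) (\<Prod>z\<leftarrow>zs. [:-z, 1:])"
    by (simp add: f_def)
  also have "\<dots> = p"
    by (subst (2) complex_poly_decompose_multiset[symmetric])
       (simp flip: zs(1) add: prod_mset_prod_list flip: mset_map)
  finally have "p = ?\<Phi> f" ..
  moreover have "f \<in> ?S"
    using p zs(2) len leading_coeff_neq_0[of p] by (auto simp: f_def labelled_roots_def)
  ultimately show "p \<in> ?\<Phi> ` ?S" by (rule image_eqI)
next
  fix p assume "p \<in> ?\<Phi> ` ?S"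
  then obtain f where f: "f \<in> ?S" "p = ?\<Phi> f" by blast
  have fi: "lab (f i) = Ds ! i" if "i < n" for i using PiE_mem[OF f(1), of i] that by simp
  have fn: "f n \<noteq> 0" using PiE_mem[OF f(1), of n] by simp
  have p: "p = smult (f n) (\<Prod>z\<leftarrow>map f [0..<n]. [:-z, 1:])"
    using f(2) by (simp add: o_def)
  have "map lab (map f [0..<n]) = Ds"
    by (rule nth_equalityI) (auto simp: assms fi)
  moreover have "proots p = mset (map f [0..<n])"
    unfolding p proots_smult[OF fn] by (rule proots_prod_linear)
  ultimately have "image_mset lab (proots p) = mset Ds"
    by (metis mset_map)
  moreover have "degree p = n"
    unfolding p using fn by (simp only: degree_smult_eq degree_prod_linear if_False) simp
  moreover have "p \<noteq> 0"
  proof -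
    have "(\<Prod>z\<leftarrow>map f [0..<n]. [:-z, 1:]) \<noteq> 0"
      by (subst prod_list_zero_iff) auto
    then show ?thesis unfolding p using fn by simp
  qed
  ultimately show "p \<in> ?N" by (simp add: labelled_roots_def)
qed

text \<open>A continuous image of a product of connected sets: every root moves inside its own connected
  label class, and the plane without the origin, where the leading coefficient moves, is
  connected.\<close>

lemma connectedin_labelled_roots:
  assumes "\<And>D. D \<in># \<nu> \<Longrightarrow> connected (lab -` {D})" "size \<nu> = n"
  shows "connectedin (poly_topology n) (labelled_roots n lab \<nu>)"
proof -
  obtain Ds where Ds: "\<nu> = mset Ds" by (metis ex_mset)
  then have len: "length Ds = n" using assms(2) by simp
  define \<Phi> :: "(nat \<Rightarrow> complex) \<Rightarrow> complex poly" where
    "\<Phi> = (\<lambda>f. smult (f n) (\<Prod>i\<leftarrow>[0..<n]. [:- f i, 1:]))"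
  define S where "S = (\<Pi>\<^sub>E i\<in>(UNIV::nat set). if i < n then lab -` {Ds ! i} else - {0})"
  have "connected (- {0::complex})"
    by (rule connected_punctured_universe) simp
  then have "connectedin (product_topology (\<lambda>_. euclidean) UNIV) S"
    unfolding S_def using assms(1) len by (subst connectedin_PiE) (auto simp: Ds)
  then have conn: "connectedin euclidean S"
    by (simp only: euclidean_product_topology)
  have cont1: "continuous_on UNIV (\<lambda>f. coeff (\<Prod>i\<leftarrow>js. [:- f i, 1::complex:]) j)" for js :: "nat list" and j
  proof (induction js arbitrary: j)
    case (Cons a js)
    have "continuous_on UNIV (\<lambda>f. (case j of 0 \<Rightarrow> 0 | Suc j' \<Rightarrow> coeff (\<Prod>i\<leftarrow>js. [:- f i, 1::complex:]) j')
        - f a * coeff (\<Prod>i\<leftarrow>js. [:- f i, 1:]) j)"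
      by (cases j) (auto intro!: continuous_intros Cons.IH)
    moreover have "coeff (\<Prod>i\<leftarrow>a # js. [:- f i, 1::complex:]) j =
        (case j of 0 \<Rightarrow> 0 | Suc j' \<Rightarrow> coeff (\<Prod>i\<leftarrow>js. [:- f i, 1:]) j') - f a * coeff (\<Prod>i\<leftarrow>js. [:- f i, 1:]) j"
      for f :: "nat \<Rightarrow> complex"
      by (simp add: coeff_pCons split: nat.split)
    ultimately show ?case by (simp only:)
  qed simp
  have "continuous_on UNIV (\<lambda>f. coeff (\<Phi> f) j)" for j
    unfolding \<Phi>_def coeff_smult by (intro continuous_on_mult cont1 continuous_on_product_coordinates)
  then have "continuous_on UNIV (coeff \<circ> \<Phi>)"
    by (auto simp: o_def intro!: continuous_on_coordinatewise_then_product)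
  moreover have "degree (\<Phi> f) \<le> n" for f
  proof -
    have "degree (\<Phi> f) \<le> degree (\<Prod>z\<leftarrow>map f [0..<n]. [:-z, 1:])"
      by (simp add: \<Phi>_def o_def degree_smult_le)
    then show ?thesis by (simp only: degree_prod_linear) simp
  qed
  ultimately have "continuous_map euclidean (poly_topology n) \<Phi>"
    unfolding poly_topology_def by (intro continuous_map_pullback') auto
  from connectedin_continuous_map_image[OF this conn] show ?thesis
    unfolding Ds labelled_roots_eq_image[OF len] \<Phi>_def S_def .
qed

lemma labelled_roots_nonempty:
  assumes "set_mset \<nu> \<subseteq> range lab" "size \<nu> = n"
  shows "labelled_roots n lab \<nu> \<noteq> {}"
proof -
  obtain Ds where Ds: "\<nu> = mset Ds" by (metis ex_mset)
  then have len: "length Ds = n" using assms(2) by simp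
  have "\<exists>z. lab z = Ds ! i" if "i < n" for i
    using assms(1) len that unfolding Ds by (metis nth_mem rangeE set_mset_mset subset_iff)
  then obtain z where "\<And>i. i < n \<Longrightarrow> lab (z i) = Ds ! i" by metis
  then have "(\<lambda>i. if i < n then z i else 1) \<in> (\<Pi>\<^sub>E i\<in>UNIV. if i < n then lab -` {Ds ! i} else - {0})"
    by auto
  then show ?thesis unfolding Ds labelled_roots_eq_image[OF len] by blast
qed

text \<open>The count of components is reduced to a count of label multisets. The sets of polynomials with
  a given label multiset are connected, so only their openness in the stratum is at stake. A
  label may change under a small motion of a root, but only towards a label of smaller weight
  \<open>\<tau>\<close>. On the stratum the total weight of the roots is the constant \<open>t\<close>; hence no weight can
  drop, and then no label changes.\<close>

proposition components_of_labelled_strata: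
  fixes lab :: "complex \<Rightarrow> 'b" and \<tau> :: "'b \<Rightarrow> nat"
  assumes conn: "\<And>D. D \<in> range lab \<Longrightarrow> connected (lab -` {D})"
    and loc: "\<And>z. \<forall>\<^sub>F w in nhds z. \<tau> (lab w) \<le> \<tau> (lab z) \<and> (\<tau> (lab w) = \<tau> (lab z) \<longrightarrow> lab w = lab z)"
    and M: "\<And>\<nu>. \<nu> \<in> M \<Longrightarrow> set_mset \<nu> \<subseteq> range lab" "\<And>\<nu>. \<nu> \<in> M \<Longrightarrow> size \<nu> = n"
      "\<And>\<nu>. \<nu> \<in> M \<Longrightarrow> (\<Sum>D\<in>#\<nu>. \<tau> D) = t"
  shows "connected_components_of (subtopology (poly_topology n) (\<Union>\<nu>\<in>M. labelled_roots n lab \<nu>)) =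
           labelled_roots n lab ` M"
    and "inj_on (labelled_roots n lab) M"
proof -
  let ?N = "labelled_roots n lab"
  define S where "S = (\<Union>\<nu>\<in>M. ?N \<nu>)"
  have open_N: "openin (subtopology (poly_topology n) S) (?N \<nu>)" if \<nu>: "\<nu> \<in> M" for \<nu>
  proof (subst openin_subopen, intro ballI)
    fix p assume p: "p \<in> ?N \<nu>"
    then have p': "p \<noteq> 0" "degree p = n" "image_mset lab (proots p) = \<nu>" by (auto simp: labelled_roots_def)
    obtain zs where zs: "mset zs = proots p" by (metis ex_mset)
    have len: "length zs = n" using zs p'(2) by (metis size_mset size_proots_complex)
    define R where "R = (\<lambda>i w. \<tau> (lab w) \<le> \<tau> (lab (zs ! i)) \<and> (\<tau> (lab w) = \<tau> (lab (zs ! i)) \<longrightarrow> lab w = lab (zs ! i)))"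
    from roots_close[OF p'(1,2) zs, of R] loc obtain e where e: "e > 0"
      "\<And>q. degree q = n \<Longrightarrow> (\<forall>i\<le>n. dist (coeff q i) (coeff p i) < e) \<Longrightarrow>
           \<exists>ws. length ws = n \<and> mset ws = proots q \<and> (\<forall>i<n. R i (ws ! i))"
      unfolding R_def by blast
    define V where "V = (\<Inter>i\<in>{..n}. {f. dist (f i) (coeff p i) < e})"
    define T where "T = coeff -` V \<inter> {q. degree q \<le> n}"
    have "open V" unfolding V_def
      by (intro open_INT ballI finite_atMost open_Collect_less continuous_intros) auto
    then have "openin (poly_topology n) T"
      unfolding poly_topology_def openin_pullback_topology open_openin[symmetric] T_def by blast
    then have "openin (subtopology (poly_topology n) S) (S \<inter> T)"
      by (metis openin_subtopology Int_commute)
    moreover have "p \<in> S \<inter> T"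
      using p \<nu> p' e(1) by (auto simp: S_def T_def V_def)
    moreover have "S \<inter> T \<subseteq> ?N \<nu>"
    proof
      fix q assume q: "q \<in> S \<inter> T"
      then obtain \<mu> where \<mu>: "\<mu> \<in> M" "q \<noteq> 0" "degree q = n" "image_mset lab (proots q) = \<mu>"
        by (auto simp: S_def labelled_roots_def)
      from e(2)[OF \<mu>(3)] q obtain ws where ws: "length ws = n" "mset ws = proots q" "\<And>i. i < n \<Longrightarrow> R i (ws ! i)"
        by (auto simp: T_def V_def)
      have sum: "(\<Sum>D\<in>#image_mset lab (mset xs). \<tau> D) = (\<Sum>i<n. \<tau> (lab (xs ! i)))" if "length xs = n" for xs
        using that by (simp add: sum_mset_sum_list sum_list_sum_nth atLeast0LessThan flip: mset_map)
      have "(\<Sum>i<n. \<tau> (lab (ws ! i))) = (\<Sum>i<n. \<tau> (lab (zs ! i)))"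
        using M(3)[OF \<nu>] M(3)[OF \<mu>(1)] sum[OF len] sum[OF ws(1)] zs ws(2) p'(3) \<mu>(4) by simp
      then have "\<tau> (lab (ws ! i)) = \<tau> (lab (zs ! i))" if "i < n" for i
        by (rule sum_mono_inv) (use ws(3) that in \<open>auto simp: R_def\<close>)
      then have "lab (ws ! i) = lab (zs ! i)" if "i < n" for i
        using ws(3)[OF that] that by (auto simp: R_def)
      then have "map lab ws = map lab zs"
        by (intro nth_equalityI) (auto simp: ws(1) len)
      then have "image_mset lab (proots q) = \<nu>"
        using p'(3) by (metis zs ws(2) mset_map)
      then show "q \<in> ?N \<nu>" using \<mu> by (simp add: labelled_roots_def)
    qed
    ultimately show "\<exists>T. openin (subtopology (poly_topology n) S) T \<and> p \<in> T \<and> T \<subseteq> ?N \<nu>" by blast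
  qed
  have ne: "?N \<nu> \<noteq> {}" if "\<nu> \<in> M" for \<nu>
    using M that by (intro labelled_roots_nonempty) auto
  have disj: "?N \<nu> \<inter> ?N \<mu> = {}" if "\<nu> \<noteq> \<mu>" for \<nu> \<mu>
    using that by (auto simp: labelled_roots_def)
  show "inj_on ?N M"
    using ne disj by (metis inf.idem inj_onI)
  have "connected_components_of (subtopology (poly_topology n) S) = ?N ` M"
  proof (rule connected_components_of_open_partition)
    show "openin (subtopology (poly_topology n) S) C" if "C \<in> ?N ` M" for C
      using that open_N by auto
    show "connectedin (subtopology (poly_topology n) S) C" if C: "C \<in> ?N ` M" for C
    proof -
      obtain \<nu> where \<nu>: "\<nu> \<in> M" "C = ?N \<nu>" using C by auto
      have "connectedin (poly_topology n) (?N \<nu>)"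
        by (rule connectedin_labelled_roots) (use M[OF \<nu>(1)] conn in blast)+
      then show ?thesis using \<nu> by (auto simp: connectedin_subtopology S_def)
    qed
    show "{} \<notin> ?N ` M" using ne by auto
    show "pairwise disjnt (?N ` M)"
      using disj by (intro pairwise_imageI) (auto simp: disjnt_def)
    show "\<Union> (?N ` M) = topspace (subtopology (poly_topology n) S)"
      by (auto simp: S_def labelled_roots_def)
  qed
  then show "connected_components_of (subtopology (poly_topology n) (\<Union>\<nu>\<in>M. ?N \<nu>)) = ?N ` M"
    by (simp add: S_def)
qed

section \<open>Bivariate polynomials on horizontal lines\<close>

definition eval2 :: "real poly poly \<Rightarrow> real \<Rightarrow> real \<Rightarrow> real" where
  "eval2 P x y = poly (poly P [:x:]) y"

text \<open>The restriction of a bivariate polynomial to the horizontal line at height \<open>y\<close>. Its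
  coefficients are real, but it is taken over the complex numbers so that it has as many roots
  as its degree.\<close>

definition fibre_poly :: "real \<Rightarrow> real poly poly \<Rightarrow> complex poly" where
  "fibre_poly y P = map_poly (\<lambda>c. of_real (poly c y)) P"

lemma coeff_fibre_poly [simp]: "coeff (fibre_poly y P) i = of_real (poly (coeff P i) y)"
  by (simp add: fibre_poly_def coeff_map_poly)

lemma fibre_poly_add: "fibre_poly y (P + Q) = fibre_poly y P + fibre_poly y Q"
  by (rule poly_eqI) simp

lemma fibre_poly_mult: "fibre_poly y (P * Q) = fibre_poly y P * fibre_poly y Q"
  by (rule poly_eqI) (simp add: coeff_mult poly_sum)

lemma fibre_poly_pderiv: "fibre_poly y (pderiv P) = pderiv (fibre_poly y P)"
  by (rule poly_eqI) (simp add: coeff_pderiv del: of_nat_Suc)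

lemma fibre_poly_const: "fibre_poly y [:c:] = [:of_real (poly c y):]"
  by (simp add: fibre_poly_def map_poly_pCons)

lemma degree_fibre_poly: "poly (lead_coeff P) y \<noteq> 0 \<Longrightarrow> degree (fibre_poly y P) = degree P"
  by (rule antisym) (auto simp: fibre_poly_def map_poly_degree_leq coeff_map_poly intro!: le_degree)

lemma poly_fibre_poly_of_real: "poly (fibre_poly y P) (of_real x) = of_real (eval2 P x y)"
  unfolding eval2_def
  by (induction P) (simp_all add: fibre_poly_def map_poly_pCons)

lemma cnj_poly_fibre_poly: "cnj (poly (fibre_poly y P) z) = poly (fibre_poly y P) (cnj z)"
proof -
  have "map_poly cnj (fibre_poly y P) = fibre_poly y P"
    by (rule poly_eqI) (simp add: coeff_map_poly)
  then show ?thesis by (metis poly_cnj)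
qed

lemma eval2_mult: "eval2 (P * Q) x y = eval2 P x y * eval2 Q x y"
  by (simp add: eval2_def)

lemma continuous_on_eval2 [continuous_intros]:
  assumes "continuous_on S f" "continuous_on S g"
  shows "continuous_on S (\<lambda>t. eval2 P (f t) (g t))"
  unfolding eval2_def
proof (induction P)
  case (pCons a P)
  then show ?case by (auto intro!: continuous_intros assms)
qed simp

lemma tendsto_eval2 [tendsto_intros]:
  assumes "(f \<longlongrightarrow> a) F" "(g \<longlongrightarrow> b) F"
  shows "((\<lambda>t. eval2 P (f t) (g t)) \<longlongrightarrow> eval2 P a b) F"
  unfolding eval2_def
proof (induction P)
  case (pCons c P)
  then show ?case by (auto intro!: tendsto_intros assms)
qed simp

lemma exists_prime_factor_degree_pos:
  fixes D :: "real poly poly"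
  assumes "degree D > 0"
  shows "\<exists>f. prime f \<and> f dvd D \<and> degree f > 0"
  using assms
proof (induction D rule: prime_divisors_induct)
  case zero
  then show ?case by simp
next
  case (unit D)
  then obtain c where "D = [:c:]" by (auto simp only: is_unit_poly_iff)
  with unit.prems show ?case by simp
next
  case (factor p D)
  show ?case
  proof (cases "degree p > 0")
    case True
    then show ?thesis using factor.hyps by (intro exI[of _ p]) simp
  next
    case False
    have "p * D \<noteq> 0" using factor.prems by (intro notI) simp
    then have "degree D > 0" using factor.prems False by (simp add: degree_mult_eq)
    from factor.IH[OF this] obtain f where "prime f" "f dvd D" "degree f > 0" by blast
    then show ?thesis by (intro exI[of _ f] conjI dvd_mult)
  qed
qed

lemma exists_vanishing_prime_factor:
  fixes P :: "real poly poly"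
  assumes "eval2 P x y = 0" "P \<noteq> 0"
  shows "\<exists>f. prime f \<and> f dvd P \<and> eval2 f x y = 0"
  using assms
proof (induction P rule: prime_divisors_induct)
  case zero
  then show ?case by simp
next
  case (unit P)
  then obtain Q where "1 = P * Q" unfolding dvd_def by blast
  then have "eval2 1 x y = eval2 P x y * eval2 Q x y" by (metis eval2_mult)
  then show ?case using unit.prems by (simp add: eval2_def)
next
  case (factor p P)
  show ?case
  proof (cases "eval2 p x y = 0")
    case True
    then show ?thesis using factor.hyps by (intro exI[of _ p]) simp
  next
    case False
    then have "eval2 P x y = 0" "P \<noteq> 0" using factor.prems by (simp_all add: eval2_mult)
    from factor.IH[OF this] obtain f where "prime f" "f dvd P" "eval2 f x y = 0" by blast
    then show ?thesis by (intro exI[of _ f] conjI dvd_mult)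
  qed
qed

text \<open>Without a common factor that involves the outer indeterminate, the two polynomials generate an
  ideal containing a nonzero polynomial in the inner indeterminate alone. Indeed, an element of
  least degree divides the generators up to constants, by pseudo-division, and a prime factor of it
  of positive degree would be a common factor.\<close>

lemma bezout_constant:
  fixes P Q :: "real poly poly"
  assumes "P \<noteq> 0" and coprime: "\<And>f. prime f \<Longrightarrow> f dvd P \<Longrightarrow> f dvd Q \<Longrightarrow> degree f = 0"
  shows "\<exists>A B r. r \<noteq> 0 \<and> A * P + B * Q = [:r:]"
proof -
  define \<I> where "\<I> = {D. \<exists>A B. D = A * P + B * Q}"
  have PQ: "P \<in> \<I>" "Q \<in> \<I>"
    unfolding \<I>_def by (auto intro: exI[of _ 1] exI[of _ 0])
  have lin: "smult a X - Y * Z \<in> \<I>" if "X \<in> \<I>" "Y \<in> \<I>" for a X Y Z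
  proof -
    obtain A B A' B' where "X = A * P + B * Q" "Y = A' * P + B' * Q"
      using \<open>X \<in> \<I>\<close> \<open>Y \<in> \<I>\<close> unfolding \<I>_def by blast
    then have "smult a X - Y * Z = (smult a A - A' * Z) * P + (smult a B - B' * Z) * Q"
      by (simp add: algebra_simps smult_add_right)
    then show ?thesis unfolding \<I>_def by blast
  qed
  obtain D where D: "D \<in> \<I>" "D \<noteq> 0" "\<And>E. E \<in> \<I> \<Longrightarrow> E \<noteq> 0 \<Longrightarrow> degree D \<le> degree E"
    using ex_has_least_nat[of "\<lambda>D. D \<in> \<I> \<and> D \<noteq> 0" P degree] PQ(1) \<open>P \<noteq> 0\<close> by auto
  have division: "\<exists>a. a \<noteq> 0 \<and> D dvd [:a:] * X" if "X \<in> \<I>" for X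
  proof -
    obtain a q where aq: "a \<noteq> 0" "smult a X = D * q + pseudo_mod X D"
      using pseudo_mod(1)[OF D(2)] by blast
    have "pseudo_mod X D \<in> \<I>"
      using lin[OF that D(1), of a q] aq(2) by simp
    then have "pseudo_mod X D = 0"
      using pseudo_mod(2)[OF D(2), of X] D(3) by force
    then show ?thesis using aq by (intro exI[of _ a]) auto
  qed
  have "degree D = 0"
  proof (rule ccontr)
    assume "degree D \<noteq> 0"
    then obtain f where f: "prime f" "f dvd D" "degree f > 0"
      using exists_prime_factor_degree_pos[of D] by auto
    have "f dvd X" if X: "X \<in> \<I>" for X
    proof -
      obtain a where a: "a \<noteq> 0" "D dvd [:a:] * X" using division[OF X] by blast
      have "\<not> f dvd [:a:]"
        using dvd_imp_degree_le[of f "[:a:]"] a(1) f(3) by auto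
      then show ?thesis
        using f a(2) by (metis dvd_trans prime_dvd_mult_iff)
    qed
    then show False using coprime[OF f(1)] PQ f(3) by auto
  qed
  then obtain r where "D = [:r:]" by (rule degree_eq_zeroE)
  then show ?thesis using D(1,2) unfolding \<I>_def by auto metis
qed

text \<open>A product of distinct primes is squarefree, so it has no factor of positive degree in common
  with its derivative. The nonzero polynomial \<open>r\<close> from the Bezout relation then plays the part of
  the discriminant: away from its finitely many roots, and from those of the leading coefficient,
  the restriction to a horizontal line keeps its degree and has only simple complex roots.\<close>

lemma squarefree_fibres:
  fixes S :: "real poly poly set"
  assumes "finite S" and prime: "\<And>f. f \<in> S \<Longrightarrow> prime f"
  defines "F \<equiv> \<Prod>S"
  shows "\<exists>B. finite B \<and> (\<forall>y. y \<notin> B \<longrightarrow> poly (lead_coeff F) y \<noteq> 0 \<and>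
           (\<forall>z. poly (fibre_poly y F) z = 0 \<longrightarrow> poly (pderiv (fibre_poly y F)) z \<noteq> 0))"
proof -
  have "0 \<notin> S" using prime not_prime_0 by blast
  then have F0: "F \<noteq> 0" using \<open>finite S\<close> by (simp add: F_def)
  have mem: "f \<in> T" if f: "prime f" "f dvd \<Prod>T" and T: "T \<subseteq> S" for f T
  proof -
    have "finite T" using T \<open>finite S\<close> by (rule finite_subset)
    then obtain g where g: "g \<in> T" "f dvd g"
      using f(2) unfolding prime_dvd_prod_iff[OF \<open>finite T\<close> f(1)] by blast
    have "prime g" using g(1) T by (intro prime) blast
    from primes_dvd_imp_eq[OF f(1) this g(2)] show ?thesis using g(1) by (simp only:)
  qed
  have "degree f = 0" if f: "prime f" "f dvd F" "f dvd pderiv F" for f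
  proof (rule ccontr)
    assume deg: "degree f \<noteq> 0"
    have fS: "f \<in> S" using mem[OF f(1), of S] f(2) by (simp add: F_def)
    define G where "G = \<Prod>(S - {f})"
    have "F = f * G" using prod.remove[OF \<open>finite S\<close> fS, of "\<lambda>x. x"] by (simp only: F_def G_def)
    then have "pderiv F = f * pderiv G + G * pderiv f" by (simp only: pderiv_mult)
    then have "f dvd G * pderiv f"
      using f(3) dvd_add_right_iff[of f "f * pderiv G" "G * pderiv f"] by (simp only: dvd_triv_left)
    then consider "f dvd G" | "f dvd pderiv f"
      using prime_dvd_mult_iff[OF f(1)] by blast
    then show False
    proof cases
      case 1
      then have "f \<in> S - {f}" unfolding G_def by (intro mem[OF f(1)]) auto
      then show False by blast
    next
      case 2
      have "pderiv f \<noteq> 0" using deg by (simp add: pderiv_eq_0_iff)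
      from dvd_imp_degree_le[OF 2 this] show False using deg by (simp add: degree_pderiv)
    qed
  qed
  then obtain A B r where r: "r \<noteq> 0" "A * F + B * pderiv F = [:r:]"
    using bezout_constant[OF F0, of "pderiv F"] by blast
  have "poly (lead_coeff F) y \<noteq> 0 \<and>
      (\<forall>z. poly (fibre_poly y F) z = 0 \<longrightarrow> poly (pderiv (fibre_poly y F)) z \<noteq> 0)"
    if y: "y \<notin> {y. poly (lead_coeff F * r) y = 0}" for y
  proof (intro conjI allI impI notI)
    show False if "poly (lead_coeff F) y = 0" using that y by simp
    fix z assume z: "poly (fibre_poly y F) z = 0" "poly (pderiv (fibre_poly y F)) z = 0"
    have "poly (fibre_poly y (A * F + B * pderiv F)) z = 0"
      using z by (simp add: fibre_poly_add fibre_poly_mult fibre_poly_pderiv)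
    then have "poly r y = 0" unfolding r(2) by (simp add: fibre_poly_const)
    then show False using y by simp
  qed
  moreover have "finite {y. poly (lead_coeff F * r) y = 0}"
    using F0 r(1) by (intro poly_roots_finite) auto
  ultimately show ?thesis by blast
qed

section \<open>Real roots as continuous functions of the parameter\<close>

definition real_roots :: "real poly poly \<Rightarrow> real \<Rightarrow> real set" where
  "real_roots F y = {x. eval2 F x y = 0}"

lemma finite_real_roots:
  assumes "poly (lead_coeff F) y \<noteq> 0"
  shows "finite (real_roots F y)"
proof -
  have "fibre_poly y F \<noteq> 0" using assms by (metis coeff_0 coeff_fibre_poly of_real_eq_0_iff)
  then have "finite {z. poly (fibre_poly y F) z = 0}" by (rule poly_roots_finite)
  moreover have "real_roots F y = of_real -` {z. poly (fibre_poly y F) z = 0}"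
    by (auto simp: real_roots_def poly_fibre_poly_of_real)
  ultimately show ?thesis using finite_vimageI[OF _ inj_of_real] by metis
qed

text \<open>The complex roots over nearby heights can be listed continuously, and they stay distinct. As the
  roots are stable under conjugation, the listed root near a real root must be its own conjugate:
  its conjugate is a listed root, and all the others converge to different limits. So real roots
  remain real, non-real ones remain non-real, and the order of the real roots is preserved.\<close>

lemma real_roots_locally_continuous:
  assumes lc: "poly (lead_coeff F) y\<^sub>0 \<noteq> 0"
    and simple: "\<And>z. poly (fibre_poly y\<^sub>0 F) z = 0 \<Longrightarrow> poly (pderiv (fibre_poly y\<^sub>0 F)) z \<noteq> 0"
  shows "\<forall>\<^sub>F y in at y\<^sub>0. card (real_roots F y) = card (real_roots F y\<^sub>0)"
    and "i < card (real_roots F y\<^sub>0) \<Longrightarrow>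
      ((\<lambda>y. sorted_list_of_set (real_roots F y) ! i) \<longlongrightarrow> sorted_list_of_set (real_roots F y\<^sub>0) ! i) (at y\<^sub>0)"
proof -
  define p where "p = fibre_poly y\<^sub>0 F"
  define n where "n = degree F"
  have degp: "degree p = n" using lc by (simp add: p_def n_def degree_fibre_poly)
  have p0: "p \<noteq> 0" using lc unfolding p_def by (metis coeff_0 coeff_fibre_poly of_real_eq_0_iff)
  obtain zs where zs: "mset zs = proots p" by (metis ex_mset)
  have len: "length zs = n" using zs degp by (metis size_mset size_proots_complex)
  have "count (mset zs) z \<le> 1" for z
  proof (cases "poly p z = 0")
    case True
    then have "poly (pderiv p) z \<noteq> 0" using simple by (simp add: p_def)
    then have "order z (pderiv p) = 0" by (simp add: order_root)
    then have "order z p = 1"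
      using True p0 order_pderiv[of p z] by (metis order_root order_gt_0_iff One_nat_def pderiv_eq_0_iff)
    then show ?thesis using p0 zs by simp
  next
    case False
    then show ?thesis using p0 zs by (simp add: order_root)
  qed
  then have dist: "distinct zs"
    by (simp add: distinct_count_atmost_1) (metis One_nat_def count_mset_0_iff le_Suc_eq le_zero_eq)
  have lim: "((\<lambda>y. coeff (fibre_poly y F) i) \<longlongrightarrow> coeff p i) (at y\<^sub>0)" for i
    unfolding p_def coeff_fibre_poly by (intro tendsto_intros)
  have "((\<lambda>y. poly (lead_coeff F) y) \<longlongrightarrow> poly (lead_coeff F) y\<^sub>0) (at y\<^sub>0)"
    by (intro tendsto_intros)
  then have lc_ev: "\<forall>\<^sub>F y in at y\<^sub>0. poly (lead_coeff F) y \<noteq> 0"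
    using lc by (rule tendsto_imp_eventually_ne)
  then have "\<forall>\<^sub>F y in at y\<^sub>0. degree (fibre_poly y F) = length zs"
    by eventually_elim (simp add: degree_fibre_poly len n_def)
  moreover have "p = smult (lead_coeff p) (\<Prod>z\<leftarrow>zs. [:-z, 1:])"
    by (subst (1) complex_poly_decompose_multiset[symmetric])
       (simp flip: zs add: prod_mset_prod_list flip: mset_map)
  ultimately have "\<exists>ws. (\<forall>t. length (ws t) = length zs) \<and> (\<forall>\<^sub>F t in at y\<^sub>0. mset (ws t) = proots (fibre_poly t F)) \<and>
              (\<forall>i<length zs. ((\<lambda>t. ws t ! i) \<longlongrightarrow> zs ! i) (at y\<^sub>0))"
    by (intro roots_converge[where c = "lead_coeff p"]) (use lim p0 in auto)
  then obtain ws where ws: "\<And>y. length (ws y) = n"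
    "\<forall>\<^sub>F y in at y\<^sub>0. mset (ws y) = proots (fibre_poly y F)"
    "\<And>i. i < n \<Longrightarrow> ((\<lambda>y. ws y ! i) \<longlongrightarrow> zs ! i) (at y\<^sub>0)"
    unfolding len by blast
  have "\<forall>\<^sub>F y in at y\<^sub>0. \<forall>i\<in>{..<n}. \<forall>j\<in>{..<n}.
      cnj (zs ! i) \<noteq> zs ! j \<longrightarrow> cnj (ws y ! i) \<noteq> ws y ! j"
  proof (intro eventually_ball_finite ballI finite_lessThan)
    fix i j assume ij: "i \<in> {..<n}" "j \<in> {..<n}"
    have "((\<lambda>y. cnj (ws y ! i) - ws y ! j) \<longlongrightarrow> cnj (zs ! i) - zs ! j) (at y\<^sub>0)"
      using ij by (intro tendsto_intros ws(3)) auto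
    then have "cnj (zs ! i) \<noteq> zs ! j \<Longrightarrow> \<forall>\<^sub>F y in at y\<^sub>0. cnj (ws y ! i) - ws y ! j \<noteq> 0"
      by (rule tendsto_imp_eventually_ne) simp
    then show "\<forall>\<^sub>F y in at y\<^sub>0. cnj (zs ! i) \<noteq> zs ! j \<longrightarrow> cnj (ws y ! i) \<noteq> ws y ! j"
      by (cases "cnj (zs ! i) = zs ! j") auto
  qed
  then have reality: "\<forall>\<^sub>F y in at y\<^sub>0. \<forall>i<n. ws y ! i \<in> \<real> \<longleftrightarrow> zs ! i \<in> \<real>"
    using ws(2) lc_ev
  proof eventually_elim
    case (elim y)
    have fib0: "fibre_poly y F \<noteq> 0" using elim(3) by (metis coeff_0 coeff_fibre_poly of_real_eq_0_iff)
    show ?case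
    proof (intro allI impI iffI)
      fix i assume i: "i < n"
      {
        assume "ws y ! i \<in> \<real>"
        then have "cnj (zs ! i) = zs ! i" using elim(1) i by (metis Reals_cnj_iff lessThan_iff)
        then show "zs ! i \<in> \<real>" by (simp add: Reals_cnj_iff)
      }
      assume real: "zs ! i \<in> \<real>"
      have "ws y ! i \<in># proots (fibre_poly y F)"
        using i ws(1) by (metis elim(2) nth_mem set_mset_mset)
      then have "poly (fibre_poly y F) (cnj (ws y ! i)) = 0"
        using fib0 by (simp flip: cnj_poly_fibre_poly)
      then have "cnj (ws y ! i) \<in># mset (ws y)" unfolding elim(2) using fib0 by simp
      then obtain j where j: "j < n" "cnj (ws y ! i) = ws y ! j"
        by (metis in_set_conv_nth set_mset_mset ws(1))
      then have "zs ! i = zs ! j"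
        using elim(1) i real by (metis Reals_cnj_iff lessThan_iff)
      then have "i = j" using dist i j(1) len by (simp add: nth_eq_iff_index_eq)
      then show "ws y ! i \<in> \<real>" using j(2) by (simp add: Reals_cnj_iff)
    qed
  qed
  have zs_roots: "set zs = {z. poly p z = 0}" using zs p0 by (metis set_count_proots set_mset_mset)
  define xs where "xs = sorted_list_of_set (real_roots F y\<^sub>0)"
  define r where "r = card (real_roots F y\<^sub>0)"
  have fin: "finite (real_roots F y\<^sub>0)" using lc by (rule finite_real_roots)
  have xs: "length xs = r" "set xs = real_roots F y\<^sub>0" "sorted_wrt (<) xs"
    using fin by (auto simp: xs_def r_def)
  have "\<exists>k<n. zs ! k = of_real (xs ! j)" if "j < r" for j
  proof -
    have "xs ! j \<in> real_roots F y\<^sub>0" using that xs by (metis nth_mem)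
    then have "of_real (xs ! j) \<in> set zs"
      by (simp add: zs_roots p_def real_roots_def poly_fibre_poly_of_real)
    then show ?thesis by (metis in_set_conv_nth len)
  qed
  then obtain \<kappa> where \<kappa>: "\<And>j. j < r \<Longrightarrow> \<kappa> j < n \<and> zs ! \<kappa> j = of_real (xs ! j)" by metis
  define u where "u = (\<lambda>j y. Re (ws y ! \<kappa> j))"
  have u: "(u j \<longlongrightarrow> xs ! j) (at y\<^sub>0)" if "j < r" for j
    using tendsto_Re[OF ws(3), of "\<kappa> j"] \<kappa>[OF that] by (simp add: u_def)
  have "\<forall>\<^sub>F y in at y\<^sub>0. \<forall>i\<in>{..<r}. \<forall>j\<in>{..<r}. i < j \<longrightarrow> u i y < u j y"
  proof (intro eventually_ball_finite ballI finite_lessThan)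
    fix i j assume ij: "i \<in> {..<r}" "j \<in> {..<r}"
    have "((\<lambda>y. u j y - u i y) \<longlongrightarrow> xs ! j - xs ! i) (at y\<^sub>0)"
      using ij by (intro tendsto_intros u) auto
    moreover have "i < j \<Longrightarrow> xs ! j - xs ! i > 0"
      using xs(1,3) ij by (simp add: sorted_wrt_iff_nth_less)
    ultimately have "i < j \<Longrightarrow> \<forall>\<^sub>F y in at y\<^sub>0. 0 < u j y - u i y"
      by (simp only: order_tendstoD(1))
    then show "\<forall>\<^sub>F y in at y\<^sub>0. i < j \<longrightarrow> u i y < u j y"
      by (cases "i < j") auto
  qed
  then have sorted: "\<forall>\<^sub>F y in at y\<^sub>0. sorted_list_of_set (real_roots F y) = map (\<lambda>j. u j y) [0..<r]"
    using reality ws(2) lc_ev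
  proof eventually_elim
    case (elim y)
    have fib0: "fibre_poly y F \<noteq> 0" using elim(4) by (metis coeff_0 coeff_fibre_poly of_real_eq_0_iff)
    have wroots: "set (ws y) = {z. poly (fibre_poly y F) z = 0}"
      using elim(3) fib0 by (metis set_count_proots set_mset_mset)
    have real_u: "of_real (u j y) = ws y ! \<kappa> j" if "j < r" for j
    proof -
      have "ws y ! \<kappa> j \<in> \<real>" using elim(2) \<kappa>[OF that] by auto
      then show ?thesis by (simp add: u_def of_real_Re)
    qed
    have "(\<lambda>j. u j y) ` {0..<r} = real_roots F y"
    proof (intro equalityI subsetI)
      fix x assume "x \<in> (\<lambda>j. u j y) ` {0..<r}"
      then obtain j where j: "j < r" "x = u j y" by auto
      have "of_real x \<in> set (ws y)" using real_u[OF j(1)] \<kappa>[OF j(1)] j(2) ws(1) by (metis nth_mem)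
      then show "x \<in> real_roots F y" by (simp add: wroots real_roots_def poly_fibre_poly_of_real)
    next
      fix x assume "x \<in> real_roots F y"
      then have "of_real x \<in> set (ws y)" by (simp add: wroots real_roots_def poly_fibre_poly_of_real)
      then obtain k where k: "k < n" "ws y ! k = of_real x" by (metis in_set_conv_nth ws(1))
      then have "zs ! k \<in> \<real>" using elim(2) by (metis Reals_of_real)
      then obtain x' where x': "zs ! k = of_real x'" by (elim Reals_cases)
      have "zs ! k \<in> set zs" using k(1) len by simp
      then have "x' \<in> set xs"
        unfolding xs(2) using x' by (simp add: zs_roots p_def real_roots_def poly_fibre_poly_of_real)
      then obtain j where j: "j < r" "xs ! j = x'" by (metis in_set_conv_nth xs(1))
      then have "\<kappa> j = k" using \<kappa>[OF j(1)] x' k(1) dist len by (metis nth_eq_iff_index_eq)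
      then have "x = u j y" using real_u[OF j(1)] k(2) by (metis of_real_eq_iff)
      then show "x \<in> (\<lambda>j. u j y) ` {0..<r}" using j(1) by auto
    qed
    moreover have "sorted_wrt (<) (map (\<lambda>j. u j y) [0..<r])"
      using elim(1) by (auto simp: sorted_wrt_iff_nth_less)
    ultimately show ?case
      by (metis sorted_list_of_set.idem_if_sorted_distinct strict_sorted_iff set_map set_upt)
  qed
  show "\<forall>\<^sub>F y in at y\<^sub>0. card (real_roots F y) = card (real_roots F y\<^sub>0)"
    using sorted
  proof eventually_elim
    case (elim y)
    then have "length (sorted_list_of_set (real_roots F y)) = r" by simp
    then show ?case by (simp add: r_def)
  qed
  show "((\<lambda>y. sorted_list_of_set (real_roots F y) ! i) \<longlongrightarrow> sorted_list_of_set (real_roots F y\<^sub>0) ! i) (at y\<^sub>0)"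
    if "i < card (real_roots F y\<^sub>0)"
  proof (rule Lim_transform_eventually)
    show "(u i \<longlongrightarrow> sorted_list_of_set (real_roots F y\<^sub>0) ! i) (at y\<^sub>0)"
      using u[of i] that by (simp add: r_def xs_def)
    show "\<forall>\<^sub>F y in at y\<^sub>0. u i y = sorted_list_of_set (real_roots F y) ! i"
      using sorted by eventually_elim (use that in \<open>simp add: r_def\<close>)
  qed
qed

section \<open>Finite unions of connected sets\<close>

text \<open>Equivalent to having finitely many components, but visibly stable under unions and continuous
  images.\<close>

definition finite_connected_union :: "'a::topological_space set \<Rightarrow> bool" where
  "finite_connected_union S \<longleftrightarrow> (\<exists>\<C>. finite \<C> \<and> (\<forall>C\<in>\<C>. connected C) \<and> S = \<Union>\<C>)"

lemma finite_connected_union_connected: "connected C \<Longrightarrow> finite_connected_union C"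
  unfolding finite_connected_union_def by (intro exI[of _ "{C}"]) auto

lemma finite_connected_union_UN:
  assumes "finite I" "\<And>i. i \<in> I \<Longrightarrow> finite_connected_union (S i)"
  shows "finite_connected_union (\<Union>i\<in>I. S i)"
proof -
  obtain \<C> where "\<And>i. i \<in> I \<Longrightarrow> finite (\<C> i) \<and> (\<forall>C\<in>\<C> i. connected C) \<and> S i = \<Union>(\<C> i)"
    using assms(2) unfolding finite_connected_union_def by metis
  then show ?thesis using assms(1) unfolding finite_connected_union_def
    by (intro exI[of _ "\<Union>i\<in>I. \<C> i"]) auto
qed

lemma finite_connected_union_Un:
  assumes "finite_connected_union S" "finite_connected_union T"
  shows "finite_connected_union (S \<union> T)"
  using finite_connected_union_UN[of UNIV "\<lambda>b. if b then S else T"] assms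
  by (simp add: UNIV_bool Un_commute)

lemma finite_connected_union_image:
  assumes "finite_connected_union S" "continuous_on S f"
  shows "finite_connected_union (f ` S)"
proof -
  obtain \<C> where \<C>: "finite \<C>" "\<And>C. C \<in> \<C> \<Longrightarrow> connected C" "S = \<Union>\<C>"
    using assms(1) unfolding finite_connected_union_def by blast
  have "connected (f ` C)" if "C \<in> \<C>" for C
    using \<C>(2,3) that assms(2) by (intro connected_continuous_image) (auto intro: continuous_on_subset)
  then show ?thesis unfolding finite_connected_union_def using \<C>(1,3)
    by (intro exI[of _ "(`) f ` \<C>"]) auto
qed

lemma finite_components_if_finite_connected_union:
  assumes "finite_connected_union S"
  shows "finite (components S)"
proof -
  obtain \<C> where \<C>: "finite \<C>" "\<And>C. C \<in> \<C> \<Longrightarrow> connected C" "S = \<Union>\<C>"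
    using assms unfolding finite_connected_union_def by blast
  have "K \<in> (\<lambda>C. connected_component_set S (SOME x. x \<in> C)) ` \<C>" if K: "K \<in> components S" for K
  proof -
    obtain x where x: "x \<in> S" "K = connected_component_set S x" using K by (auto simp: components_iff)
    then obtain C where C: "C \<in> \<C>" "x \<in> C" using \<C>(3) by auto
    then have "(SOME x. x \<in> C) \<in> C" by (metis someI)
    then have "connected_component S x (SOME x. x \<in> C)"
      using \<C> C unfolding connected_component_def by (intro exI[of _ C]) auto
    then show ?thesis using x(2) C(1) connected_component_eq by fastforce
  qed
  then show ?thesis using \<C>(1) by (meson finite_imageI finite_subset subsetI)
qed

lemma finite_connected_union_Int_real:
  fixes S T :: "real set"
  assumes "finite_connected_union S" "finite_connected_union T"
  shows "finite_connected_union (S \<inter> T)"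
proof -
  obtain \<C> where \<C>: "finite \<C>" "\<And>C. C \<in> \<C> \<Longrightarrow> connected C" "S = \<Union>\<C>"
    using assms(1) unfolding finite_connected_union_def by blast
  obtain \<D> where \<D>: "finite \<D>" "\<And>C. C \<in> \<D> \<Longrightarrow> connected C" "T = \<Union>\<D>"
    using assms(2) unfolding finite_connected_union_def by blast
  have "S \<inter> T = (\<Union>C\<in>\<C>. \<Union>D\<in>\<D>. C \<inter> D)" using \<C>(3) \<D>(3) by auto
  moreover have "connected (C \<inter> D)" if "C \<in> \<C>" "D \<in> \<D>" for C D
    using \<C>(2) \<D>(2) that unfolding is_interval_connected_1[symmetric] by (intro is_interval_Int)
  ultimately show ?thesis
    by (simp only:) (intro finite_connected_union_UN finite_connected_union_connected \<C>(1) \<D>(1))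
qed

text \<open>A real number outside an interval lies to the left or to the right of all its elements, so the
  complement of an interval is a union of two intervals.\<close>

lemma finite_connected_union_Compl_real:
  fixes S :: "real set"
  assumes "finite_connected_union S"
  shows "finite_connected_union (- S)"
proof -
  obtain \<C> where \<C>: "finite \<C>" "\<And>C. C \<in> \<C> \<Longrightarrow> connected C" "S = \<Union>\<C>"
    using assms unfolding finite_connected_union_def by blast
  have compl: "finite_connected_union (- C)" if "connected C" for C :: "real set"
  proof (cases "C = {}")
    case True
    then show ?thesis by (auto intro: finite_connected_union_connected)
  next
    case False
    let ?L = "{x. \<forall>c\<in>C. x < c}" and ?R = "{x. \<forall>c\<in>C. c < x}"
    have "connected ?L" "connected ?R"
      unfolding is_interval_connected_1[symmetric] is_interval_1
      by (blast intro: le_less_trans less_le_trans)+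
    moreover have "- C = ?L \<union> ?R"
    proof -
      have "(\<forall>c\<in>C. x < c) \<or> (\<forall>c\<in>C. c < x)" if "x \<notin> C" for x
        using that \<open>connected C\<close> unfolding is_interval_connected_1[symmetric] is_interval_1
        by (metis linorder_not_le nle_le)
      then show ?thesis using False by (auto dest: less_asym)
    qed
    ultimately show ?thesis
      by (simp add: finite_connected_union_Un finite_connected_union_connected)
  qed
  have "finite_connected_union (- \<Union>\<C>)" using \<C>(1,2)
  proof (induction \<C> rule: finite_induct)
    case empty
    then show ?case by (simp add: finite_connected_union_connected)
  next
    case (insert C \<C>)
    have "- \<Union>(insert C \<C>) = (- C) \<inter> (- \<Union>\<C>)" by auto
    then show ?case using insert compl by (simp only:) (intro finite_connected_union_Int_real, auto)
  qed
  then show ?thesis using \<C>(3) by simp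
qed

lemma sgn_constant_on_connected:
  fixes g :: "'a::topological_space \<Rightarrow> real"
  assumes "connected C" "continuous_on C g" "\<And>x. x \<in> C \<Longrightarrow> g x \<noteq> 0" "x \<in> C" "y \<in> C"
  shows "sgn (g x) = sgn (g y)"
proof -
  have "connected (g ` C)" using assms(2,1) by (rule connected_continuous_image)
  then have iv: "is_interval (g ` C)" by (simp only: is_interval_connected_1)
  have opp: "\<not> (g a < 0 \<and> 0 < g b)" if ab: "a \<in> C" "b \<in> C" for a b
  proof
    assume neg: "g a < 0 \<and> 0 < g b"
    have "0 \<in> g ` C" using connectedD_interval[OF \<open>connected (g ` C)\<close>, of "g a" "g b" 0] ab neg by (simp add: less_imp_le)
    then obtain c where "c \<in> C" "g c = 0" by auto
    then show False using assms(3)[of c] by blast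
  qed
  show ?thesis using opp[OF assms(4,5)] opp[OF assms(5,4)] assms(3)[OF assms(4)] assms(3)[OF assms(5)] by (simp add: sgn_if)
qed

lemma closure_Union_finite: "finite \<C> \<Longrightarrow> closure (\<Union>\<C>) = \<Union>(closure ` \<C>)"
  by (induction \<C> rule: finite_induct) simp_all

lemma Complex_line_continuous [continuous_intros]:
  assumes "continuous_on S f" "continuous_on S g"
  shows "continuous_on S (\<lambda>t. Complex (f t) (g t))"
  unfolding Complex_eq by (intro continuous_intros assms)

section \<open>Cells cut out by disjoint graphs\<close>

text \<open>The local model of a plane curve over an interval \<open>I\<close> of heights: finitely many graphs
  \<open>x = f y\<close> that never meet. The horizontal coordinate is the real part, and the
  parameter is the imaginary part.\<close>

locale graph_system =
  fixes I :: "real set" and \<Xi> :: "(real \<Rightarrow> real) set"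
  assumes conn_I: "connected I"
    and fin_\<Xi>: "finite \<Xi>"
    and cont_\<Xi>: "\<And>f. f \<in> \<Xi> \<Longrightarrow> continuous_on I f"
    and disj_\<Xi>: "\<And>f g y. f \<in> \<Xi> \<Longrightarrow> g \<in> \<Xi> \<Longrightarrow> f \<noteq> g \<Longrightarrow> y \<in> I \<Longrightarrow> f y \<noteq> g y"
begin

text \<open>Recording on which side of each graph a point lies treats the graphs themselves, the bands
  between them and the two unbounded regions alike, and avoids numbering the graphs.\<close>

definition cell :: "((real \<Rightarrow> real) \<Rightarrow> real) \<Rightarrow> complex set" where
  "cell \<sigma> = {z. Im z \<in> I \<and> (\<forall>f\<in>\<Xi>. sgn (Re z - f (Im z)) = \<sigma> f)}"

lemma order_constant:
  assumes "f \<in> \<Xi>" "g \<in> \<Xi>" "y \<in> I" "y' \<in> I"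
  shows "sgn (f y - g y) = sgn (f y' - g y')"
proof (cases "f = g")
  case False
  have "continuous_on I (\<lambda>t. f t - g t)"
    using assms(1,2) by (intro continuous_on_diff cont_\<Xi>)
  then show ?thesis
    using disj_\<Xi>[OF assms(1,2) False] by (intro sgn_constant_on_connected[OF conn_I _ _ assms(3,4)]) auto
qed simp

text \<open>As the graphs keep their order along \<open>I\<close>, a sign vector realised over one height is realised
  over every height, and continuously: by the graph itself if some sign is zero, and otherwise by a
  point between the neighbouring graphs, or beyond the last one.\<close>

lemma cell_section:
  assumes "z \<in> cell \<sigma>"
  shows "\<exists>s. continuous_on I s \<and> (\<forall>y\<in>I. Complex (s y) y \<in> cell \<sigma>)"
proof -
  define b where "b = Im z"
  have b: "b \<in> I" and z: "\<And>f. f \<in> \<Xi> \<Longrightarrow> \<sigma> f = sgn (Re z - f b)"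
    using assms by (auto simp: cell_def b_def)
  have lt: "f y < g y" if "f \<in> \<Xi>" "g \<in> \<Xi>" "y \<in> I" "f b < g b" for f g y
    using order_constant[OF that(1,2,3) b] that(4) by (auto simp: sgn_if split: if_splits)
  have le: "f y \<le> g y" if "f \<in> \<Xi>" "g \<in> \<Xi>" "y \<in> I" "f b \<le> g b" for f g y
    using order_constant[OF that(1,2,3) b] that(4) by (auto simp: sgn_if split: if_splits)
  define L U where "L = {f \<in> \<Xi>. f b < Re z}" and "U = {f \<in> \<Xi>. f b > Re z}"
  have fin: "finite L" "finite U" using fin_\<Xi> by (auto simp: L_def U_def)
  have top: "\<exists>l\<in>L. \<forall>f\<in>L. f b \<le> l b" if "L \<noteq> {}"
    using ex_is_arg_min_if_finite[OF fin(1) that, of "\<lambda>f. - f b"] by (auto simp: is_arg_min_linorder)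
  have bot: "\<exists>u\<in>U. \<forall>f\<in>U. u b \<le> f b" if "U \<noteq> {}"
    using ex_is_arg_min_if_finite[OF fin(2) that, of "\<lambda>f. f b"] by (auto simp: is_arg_min_linorder)
  have cellI: "\<forall>y\<in>I. Complex (s y) y \<in> cell \<sigma>"
    if "\<And>y f. y \<in> I \<Longrightarrow> f \<in> L \<Longrightarrow> f y < s y" "\<And>y f. y \<in> I \<Longrightarrow> f \<in> U \<Longrightarrow> s y < f y"
       and eq: "\<And>f. f \<in> \<Xi> \<Longrightarrow> f \<notin> L \<Longrightarrow> f \<notin> U \<Longrightarrow> s = f" for s
  proof
    fix y assume y: "y \<in> I"
    have "sgn (s y - f y) = \<sigma> f" if f: "f \<in> \<Xi>" for f
    proof -
      consider "f \<in> L" | "f \<in> U" | "f \<notin> L" "f \<notin> U" by blast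
      then show ?thesis
      proof cases
        case 1
        then show ?thesis using \<open>\<And>y f. y \<in> I \<Longrightarrow> f \<in> L \<Longrightarrow> f y < s y\<close>[OF y 1] z[OF f] by (simp add: L_def)
      next
        case 2
        then show ?thesis using \<open>\<And>y f. y \<in> I \<Longrightarrow> f \<in> U \<Longrightarrow> s y < f y\<close>[OF y 2] z[OF f] by (simp add: U_def)
      next
        case 3
        then have "s = f" using f eq by blast
        moreover have "f b = Re z" using 3 f by (auto simp: L_def U_def)
        ultimately show ?thesis using z[OF f] by simp
      qed
    qed
    then show "Complex (s y) y \<in> cell \<sigma>" using y by (simp add: cell_def)
  qed
  show ?thesis
  proof (cases "\<exists>f\<in>\<Xi>. f b = Re z")
    case True
    then obtain f where f: "f \<in> \<Xi>" "f b = Re z" by blast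
    have "\<forall>y\<in>I. Complex (f y) y \<in> cell \<sigma>"
    proof (rule cellI)
      show "f' y < f y" if "y \<in> I" "f' \<in> L" for y f'
        using lt[of f' f y] that f by (auto simp: L_def)
      show "f y < f' y" if "y \<in> I" "f' \<in> U" for y f'
        using lt[of f f' y] that f by (auto simp: U_def)
      show "f = f'" if "f' \<in> \<Xi>" "f' \<notin> L" "f' \<notin> U" for f'
        using disj_\<Xi>[OF f(1) that(1) _ b] that f(2) by (auto simp: L_def U_def)
    qed
    then show ?thesis using cont_\<Xi>[OF f(1)] by blast
  next
    case False
    then have LU: "\<And>f. f \<in> \<Xi> \<Longrightarrow> f \<in> L \<or> f \<in> U" by (auto simp: L_def U_def)
    have fin': "\<exists>s. continuous_on I s \<and> (\<forall>y\<in>I. Complex (s y) y \<in> cell \<sigma>)"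
      if "continuous_on I s" "\<And>y f. y \<in> I \<Longrightarrow> f \<in> L \<Longrightarrow> f y < s y" "\<And>y f. y \<in> I \<Longrightarrow> f \<in> U \<Longrightarrow> s y < f y" for s
      using cellI[of s] that LU by blast
    have LUlt: "l y < u y" if "l \<in> L" "u \<in> U" "y \<in> I" for l u y
      using lt[of l u y] that by (auto simp: L_def U_def)
    have sub: "L \<subseteq> \<Xi>" "U \<subseteq> \<Xi>" by (auto simp: L_def U_def)
    show ?thesis
    proof (cases "L = {}")
      case L: True
      show ?thesis
      proof (cases "U = {}")
        case True
        then show ?thesis using L by (intro fin'[of "\<lambda>_. 0"]) auto
      next
        case False
        then obtain u where u: "u \<in> U" "\<forall>f\<in>U. u b \<le> f b" using bot by blast
        have "u y - 1 < f y" if "y \<in> I" "f \<in> U" for y f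
          using le[of u f y] u that sub by force
        then show ?thesis using L u sub
          by (intro fin'[of "\<lambda>y. u y - 1"] continuous_on_diff cont_\<Xi> continuous_on_const) auto
      qed
    next
      case False
      then obtain l where l: "l \<in> L" "\<forall>f\<in>L. f b \<le> l b" using top by blast
      have l': "f y \<le> l y" if "y \<in> I" "f \<in> L" for y f
        using le[of f l y] l that sub by force
      show ?thesis
      proof (cases "U = {}")
        case True
        have "f y < l y + 1" if "y \<in> I" "f \<in> L" for y f using l'[OF that] by simp
        then show ?thesis using True l sub
          by (intro fin'[of "\<lambda>y. l y + 1"] continuous_on_add cont_\<Xi> continuous_on_const) auto
      next
        case False
        then obtain u where u: "u \<in> U" "\<forall>f\<in>U. u b \<le> f b" using bot by blast
        have u': "u y \<le> f y" if "y \<in> I" "f \<in> U" for y f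
          using le[of u f y] u that sub by force
        show ?thesis
        proof (rule fin'[of "\<lambda>y. (l y + u y) / 2"])
          show "continuous_on I (\<lambda>y. (l y + u y) / 2)"
            using l u sub by (intro continuous_on_divide continuous_on_add cont_\<Xi> continuous_on_const) auto
          show "f y < (l y + u y) / 2" if "y \<in> I" "f \<in> L" for y f
            using l'[OF that] LUlt[OF l(1) u(1) that(1)] by simp
          show "(l y + u y) / 2 < f y" if "y \<in> I" "f \<in> U" for y f
            using u'[OF that] LUlt[OF l(1) u(1) that(1)] by simp
        qed
      qed
    qed
  qed
qed

lemma cell_fibre_interval:
  assumes "Complex a y \<in> cell \<sigma>" "Complex b y \<in> cell \<sigma>" "a \<le> x" "x \<le> b"
  shows "Complex x y \<in> cell \<sigma>"
proof -
  have "sgn (x - c) = t" if "sgn (a - c) = t" "sgn (b - c) = t" for c t :: real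
    using that assms(3,4) by (auto simp: sgn_if split: if_splits)
  then show ?thesis using assms(1,2) by (simp add: cell_def)
qed

text \<open>The connected graph of a section meets every horizontal fibre of the cell, and the fibres are
  intervals. The statement for subintervals \<open>J\<close> is what controls the closure of a cell over
  the endpoints of \<open>I\<close>.\<close>

lemma connected_cell_strip:
  assumes "connected J" "J \<subseteq> I"
  shows "connected (cell \<sigma> \<inter> {z. Im z \<in> J})"
proof (cases "cell \<sigma> = {} \<or> J = {}")
  case False
  then obtain s where s: "continuous_on I s" "\<And>y. y \<in> I \<Longrightarrow> Complex (s y) y \<in> cell \<sigma>"
    using cell_section by blast
  define G where "G = (\<lambda>y. Complex (s y) y) ` J"
  define fib where "fib = (\<lambda>y. (\<lambda>x. Complex x y) ` {x. Complex x y \<in> cell \<sigma>})"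
  have G: "connected G" unfolding G_def using assms s(1)
    by (intro connected_continuous_image continuous_intros) (auto intro: continuous_on_subset)
  have "connected (fib y)" for y
    unfolding fib_def
  proof (rule connected_continuous_image)
    show "connected {x. Complex x y \<in> cell \<sigma>}"
      unfolding is_interval_connected_1[symmetric] is_interval_1 using cell_fibre_interval by blast
  qed (intro continuous_intros)
  moreover have "G \<inter> fib y \<noteq> {}" if "y \<in> J" for y
    using that s(2) assms(2) by (auto simp: G_def fib_def)
  ultimately have "connected (G \<union> fib y)" if "y \<in> J" for y
    using that G by (intro connected_Un) auto
  moreover have "\<Inter> ((\<lambda>y. G \<union> fib y) ` J) \<noteq> {}"
    using False by (auto simp: G_def)
  ultimately have "connected (\<Union>y\<in>J. G \<union> fib y)"
    by (intro connected_Union) auto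
  moreover have "(\<Union>y\<in>J. G \<union> fib y) = cell \<sigma> \<inter> {z. Im z \<in> J}"
  proof (intro equalityI subsetI)
    fix z assume "z \<in> cell \<sigma> \<inter> {z. Im z \<in> J}"
    then show "z \<in> (\<Union>y\<in>J. G \<union> fib y)"
      unfolding fib_def by (intro UN_I[of "Im z"] UnI2 image_eqI[of _ _ "Re z"]) auto
  next
    fix z assume "z \<in> (\<Union>y\<in>J. G \<union> fib y)"
    then consider "z \<in> G" | y where "y \<in> J" "z \<in> fib y" by blast
    then show "z \<in> cell \<sigma> \<inter> {z. Im z \<in> J}"
      using s(2) assms(2) by cases (auto simp: G_def fib_def)
  qed
  ultimately show ?thesis by simp
qed auto

lemma connected_cell: "connected (cell \<sigma>)"
proof -
  have "cell \<sigma> \<inter> {z. Im z \<in> I} = cell \<sigma>" by (auto simp: cell_def)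
  then show ?thesis using connected_cell_strip[OF conn_I order_refl] by metis
qed

lemma finite_cells: "finite (range cell)"
proof (rule finite_subset)
  show "finite (insert {} (cell ` (\<Pi>\<^sub>E f\<in>\<Xi>. {-1, 0, 1})))"
    using fin_\<Xi> by (intro finite.insertI finite_imageI finite_PiE) simp_all
  show "range cell \<subseteq> insert {} (cell ` (\<Pi>\<^sub>E f\<in>\<Xi>. {-1, 0, 1}))"
  proof
    fix C assume "C \<in> range cell"
    then obtain \<sigma> where C: "C = cell \<sigma>" by blast
    show "C \<in> insert {} (cell ` (\<Pi>\<^sub>E f\<in>\<Xi>. {-1, 0, 1}))"
    proof (cases "C = {}")
      case False
      then obtain z where "z \<in> cell \<sigma>" unfolding C by blast
      then have "\<sigma> f = sgn (Re z - f (Im z))" if "f \<in> \<Xi>" for f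
        using that by (simp add: cell_def)
      then have "restrict \<sigma> \<Xi> \<in> (\<Pi>\<^sub>E f\<in>\<Xi>. {-1, 0, 1})"
        by (simp add: sgn_if)
      moreover have "C = cell (restrict \<sigma> \<Xi>)" unfolding C cell_def by simp
      ultimately show ?thesis by blast
    qed simp
  qed
qed

text \<open>On any horizontal line, in particular over an endpoint of \<open>I\<close>, the closure of a cell cuts out an
  interval. If it missed a point between two of its points, then the part of the cell over a
  short interval of heights would avoid a vertical segment; being connected, it would lie on
  one side of that segment, although it comes close to both points.\<close>

lemma interval_cluster_set:
  "is_interval {x. Complex x c \<in> closure (cell \<sigma>)}"
  unfolding is_interval_1
proof (intro ballI allI impI, unfold mem_Collect_eq)
  fix a b x assume a: "Complex a c \<in> closure (cell \<sigma>)" and b: "Complex b c \<in> closure (cell \<sigma>)"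
    and x: "a \<le> x \<and> x \<le> b"
  show "Complex x c \<in> closure (cell \<sigma>)"
  proof (rule ccontr)
    assume no: "Complex x c \<notin> closure (cell \<sigma>)"
    then have ab: "a < x" "x < b" using a b x by (auto simp: less_le)
    obtain e where e: "e > 0" "ball (Complex x c) e \<inter> cell \<sigma> = {}"
    proof -
      have "open (- closure (cell \<sigma>))" by (simp add: open_Compl)
      then obtain e where "e > 0" "ball (Complex x c) e \<subseteq> - closure (cell \<sigma>)"
        using no by (meson ComplI openE)
      then show ?thesis using that[of e] closure_subset[of "cell \<sigma>"] by blast
    qed
    define J where "J = I \<inter> {c - e <..< c + e}"
    define D where "D = cell \<sigma> \<inter> {z. Im z \<in> J}"
    have "connected J" unfolding J_def
      using conn_I unfolding is_interval_connected_1[symmetric] by (intro is_interval_Int is_interval_oo)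
    then have "connected D"
      unfolding D_def by (rule connected_cell_strip) (auto simp: J_def)
    then have iv: "is_interval (Re ` D)"
      unfolding is_interval_connected_1 by (intro connected_continuous_image continuous_intros)
    have miss: "x \<notin> Re ` D"
    proof
      assume "x \<in> Re ` D"
      then obtain z where z: "z \<in> cell \<sigma>" "Re z = x" "\<bar>Im z - c\<bar> < e" by (auto simp: D_def J_def)
      then have "dist (Complex x c) z = \<bar>Im z - c\<bar>" by (simp add: dist_norm cmod_def)
      then have "z \<in> ball (Complex x c) e" using z(3) by (simp only: mem_ball)
      then show False using z(1) e(2) by blast
    qed
    have near: "\<exists>z\<in>D. dist z (Complex a' c) < d" if "Complex a' c \<in> closure (cell \<sigma>)" "d > 0" for a' d
    proof -
      obtain z where z: "z \<in> cell \<sigma>" "dist z (Complex a' c) < min d e"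
        using \<open>Complex a' c \<in> closure (cell \<sigma>)\<close> \<open>d > 0\<close> e(1) by (meson closure_approachable min_less_iff_conj)
      have "\<bar>Im z - c\<bar> \<le> dist z (Complex a' c)"
        using abs_Im_le_cmod[of "z - Complex a' c"] by (simp add: dist_norm)
      then show ?thesis using z by (intro bexI[of _ z]) (auto simp: D_def J_def cell_def)
    qed
    obtain z where z: "z \<in> D" "dist z (Complex a c) < x - a" using near[OF a, of "x - a"] ab by auto
    obtain w where w: "w \<in> D" "dist w (Complex b c) < b - x" using near[OF b, of "b - x"] ab by auto
    have "Re z < x" "x < Re w"
      using z(2) w(2) abs_Re_le_cmod[of "z - Complex a c"] abs_Re_le_cmod[of "w - Complex b c"]
      by (auto simp: dist_norm)
    then show False using iv miss z(1) w(1) unfolding is_interval_1 by (meson imageI less_imp_le)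
  qed
qed

text \<open>Over an open \<open>I\<close> the closure of a nonempty cell is obtained by weakening its strict inequalities: the fibres
  are convex, so a point satisfying the weak inequalities is the end of a horizontal segment in the cell.\<close>

lemma closure_cell:
  assumes "open I" "Im z \<in> I" "cell \<sigma> \<noteq> {}"
  shows "z \<in> closure (cell \<sigma>) \<longleftrightarrow> (\<forall>f\<in>\<Xi>. sgn (Re z - f (Im z)) \<in> {0, \<sigma> f})"
proof
  assume z: "z \<in> closure (cell \<sigma>)"
  show "\<forall>f\<in>\<Xi>. sgn (Re z - f (Im z)) \<in> {0, \<sigma> f}"
  proof (rule ccontr)
    assume "\<not> ?thesis"
    then obtain f where f: "f \<in> \<Xi>" "sgn (Re z - f (Im z)) \<noteq> 0" "sgn (Re z - f (Im z)) \<noteq> \<sigma> f" by auto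
    have contf: "isCont f (Im z)"
      using cont_\<Xi>[OF f(1)] assms(1,2) by (simp add: continuous_on_eq_continuous_at)
    have "((\<lambda>w. sgn (Re w - f (Im w))) \<longlongrightarrow> sgn (Re z - f (Im z))) (nhds z)"
      using f(2) isCont_tendsto_compose[OF contf tendsto_Im[OF filterlim_ident]]
      by (intro tendsto_sgn tendsto_diff tendsto_Re filterlim_ident) auto
    moreover have "sgn (Re z - f (Im z)) \<in> - {\<sigma> f}" using f(3) by simp
    ultimately have "\<forall>\<^sub>F w in nhds z. sgn (Re w - f (Im w)) \<in> - {\<sigma> f}"
      by (intro topological_tendstoD) auto
    then obtain T where T: "open T" "z \<in> T" "\<And>w. w \<in> T \<Longrightarrow> sgn (Re w - f (Im w)) \<noteq> \<sigma> f"
      by (auto simp: eventually_nhds)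
    then have "T \<inter> cell \<sigma> \<noteq> {}" using z by (auto simp: closure_iff_nhds_not_empty)
    then show False using T(3) f(1) by (auto simp: cell_def)
  qed
next
  assume weak: "\<forall>f\<in>\<Xi>. sgn (Re z - f (Im z)) \<in> {0, \<sigma> f}"
  obtain s where "\<And>y. y \<in> I \<Longrightarrow> Complex (s y) y \<in> cell \<sigma>"
    using cell_section assms(3) by blast
  then have s: "\<And>f. f \<in> \<Xi> \<Longrightarrow> sgn (s (Im z) - f (Im z)) = \<sigma> f" using assms(2) by (simp add: cell_def)
  define d where "d = s (Im z) - Re z"
  define w where "w = (\<lambda>n. Complex (Re z + d * inverse (real (Suc n))) (Im z))"
  have "w n \<in> cell \<sigma>" for n
  proof -
    have "sgn (Re z + d * inverse (real (Suc n)) - f (Im z)) = \<sigma> f" if f: "f \<in> \<Xi>" for f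
    proof -
      define t where "t = inverse (real (Suc n))"
      have t: "0 < t" "t \<le> 1" by (auto simp: t_def inverse_le_1_iff)
      define u where "u = Re z - f (Im z)"
      define v where "v = s (Im z) - f (Im z)"
      have "Re z + d * t - f (Im z) = (1 - t) * u + t * v"
        by (simp add: u_def v_def d_def algebra_simps)
      moreover have "sgn u \<in> {0, sgn v}" using weak f s[OF f] by (simp add: u_def v_def)
      then consider "u = 0" | "u > 0" "v > 0" | "u < 0" "v < 0"
        by (auto simp: sgn_if split: if_splits)
      then have "sgn ((1 - t) * u + t * v) = sgn v"
      proof cases
        case 1
        then show ?thesis using t by (simp add: sgn_mult)
      next
        case 2
        then have "(1 - t) * u + t * v > 0" using t by (intro add_nonneg_pos) auto
        then show ?thesis using 2 by simp
      next
        case 3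
        then have "(1 - t) * u \<le> 0" "t * v < 0" using t by (auto simp: mult_le_0_iff mult_less_0_iff)
        then have "(1 - t) * u + t * v < 0" by linarith
        then show ?thesis using 3 by simp
      qed
      ultimately show ?thesis using s[OF f] by (simp add: t_def v_def)
    qed
    then show ?thesis using assms(2) by (simp add: cell_def w_def)
  qed
  moreover have "w \<longlonglongrightarrow> z"
  proof -
    have "(\<lambda>n. Re z + d * inverse (real (Suc n))) \<longlonglongrightarrow> Re z + d * 0"
      by (intro tendsto_intros LIMSEQ_inverse_real_of_nat)
    then have "w \<longlonglongrightarrow> Complex (Re z + d * 0) (Im z)" unfolding w_def by (intro tendsto_Complex tendsto_const)
    then show ?thesis by simp
  qed
  ultimately show "z \<in> closure (cell \<sigma>)" by (auto simp: closure_sequential)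
qed

text \<open>Over \<open>I\<close> the set is a union of cells.\<close>

definition saturated :: "complex set \<Rightarrow> bool" where
  "saturated S \<longleftrightarrow> (\<forall>z w. Im z \<in> I \<longrightarrow> Im w \<in> I \<longrightarrow>
     (\<forall>f\<in>\<Xi>. sgn (Re z - f (Im z)) = sgn (Re w - f (Im w))) \<longrightarrow> z \<in> S \<longrightarrow> w \<in> S)"

lemma saturated_strip:
  assumes "saturated S"
  shows "S \<inter> {z. Im z \<in> I} = \<Union>{C \<in> range cell. C \<subseteq> S}"
proof (intro equalityI subsetI)
  fix z assume z: "z \<in> S \<inter> {z. Im z \<in> I}"
  let ?C = "cell (\<lambda>f. sgn (Re z - f (Im z)))"
  have "w \<in> S" if "w \<in> ?C" for w
    using assms[unfolded saturated_def, rule_format, of z w] z that by (simp add: cell_def)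
  moreover have "z \<in> ?C" using z by (simp add: cell_def)
  ultimately show "z \<in> \<Union>{C \<in> range cell. C \<subseteq> S}" by blast
qed (auto simp: cell_def)

lemma saturated_Compl: "saturated S \<Longrightarrow> saturated (- S)"
  unfolding saturated_def by (metis Compl_iff)

lemma saturated_Int: "saturated S \<Longrightarrow> saturated T \<Longrightarrow> saturated (S \<inter> T)"
  unfolding saturated_def by (metis Int_iff)

lemma saturated_strip_finite_connected_union:
  assumes "saturated S"
  shows "finite_connected_union (S \<inter> {z. Im z \<in> I})"
  unfolding finite_connected_union_def saturated_strip[OF assms]
  using finite_cells connected_cell by (intro exI[of _ "{C \<in> range cell. C \<subseteq> S}"]) auto

lemma saturated_closure:
  assumes "open I" "saturated S"
  shows "saturated (closure S)"
  unfolding saturated_def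
proof (intro allI impI)
  fix z w assume zw: "Im z \<in> I" "Im w \<in> I" "z \<in> closure S"
    "\<forall>f\<in>\<Xi>. sgn (Re z - f (Im z)) = sgn (Re w - f (Im w))"
  have "open {z. Im z \<in> I}"
    using assms(1) by (simp add: open_vimage[of I Im, unfolded vimage_def] continuous_intros)
  then have "z \<in> closure (S \<inter> {z. Im z \<in> I})"
    using open_Int_closure_subset[of "{z. Im z \<in> I}" S] zw by (auto simp: Int_commute)
  also have "\<dots> = \<Union>(closure ` {C \<in> range cell. C \<subseteq> S})"
    unfolding saturated_strip[OF assms(2)] using finite_cells
    by (intro closure_Union_finite) (auto intro: rev_finite_subset)
  finally obtain \<sigma> where \<sigma>: "cell \<sigma> \<subseteq> S" "z \<in> closure (cell \<sigma>)" by auto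
  then have "cell \<sigma> \<noteq> {}" by auto
  then have "w \<in> closure (cell \<sigma>)"
    using closure_cell[OF assms(1)] zw \<sigma>(2) by simp
  then show "w \<in> closure S" using closure_mono[OF \<sigma>(1)] by blast
qed

end

section \<open>Components of planar semialgebraic sets\<close>

lemma semialgebraic_sign_determined:
  assumes "semialgebraic A"
  shows "\<exists>\<P>. finite \<P> \<and> 0 \<notin> \<P> \<and> (\<forall>z w. (\<forall>P\<in>\<P>. sgn (eval2 P (Re z) (Im z)) = sgn (eval2 P (Re w) (Im w)))
           \<longrightarrow> (z \<in> A \<longleftrightarrow> w \<in> A))"
  using assms
proof induction
  case (pos P)
  have "0 < a \<longleftrightarrow> sgn a = 1" for a :: real by (simp add: sgn_1_pos)
  then show ?case
    by (intro exI[of _ "{P} - {0}"]) (cases "P = 0"; simp add: eval2_def)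
next
  case (Un A B)
  then obtain \<P> \<Q> where PQ: "finite \<P>" "finite \<Q>" "0 \<notin> \<P>" "0 \<notin> \<Q>"
    "\<And>z w. (\<forall>P\<in>\<P>. sgn (eval2 P (Re z) (Im z)) = sgn (eval2 P (Re w) (Im w))) \<Longrightarrow> z \<in> A \<longleftrightarrow> w \<in> A"
    "\<And>z w. (\<forall>P\<in>\<Q>. sgn (eval2 P (Re z) (Im z)) = sgn (eval2 P (Re w) (Im w))) \<Longrightarrow> z \<in> B \<longleftrightarrow> w \<in> B"
    by blast
  have "z \<in> A \<union> B \<longleftrightarrow> w \<in> A \<union> B"
    if "\<forall>P\<in>\<P> \<union> \<Q>. sgn (eval2 P (Re z) (Im z)) = sgn (eval2 P (Re w) (Im w))" for z w
    using PQ(5,6)[of z w] that by simp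
  then show ?case using PQ(1-4) by (intro exI[of _ "\<P> \<union> \<Q>"]) simp
next
  case (Compl A)
  then show ?case by simp
qed

lemma finite_connected_union_poly_pos:
  "finite_connected_union {x::real. poly p x > 0}"
proof (cases "p = 0")
  case True
  then show ?thesis by (simp add: finite_connected_union_connected)
next
  case False
  define R where "R = {x. poly p x = 0}"
  have "finite R" using False by (simp add: R_def poly_roots_finite)
  then have "finite_connected_union (\<Union>r\<in>R. {r})"
    by (intro finite_connected_union_UN finite_connected_union_connected) auto
  then have "finite_connected_union (- R)"
    by (intro finite_connected_union_Compl_real) simp
  then obtain \<C> where \<C>: "finite \<C>" "\<And>C. C \<in> \<C> \<Longrightarrow> connected C" "- R = \<Union>\<C>"
    unfolding finite_connected_union_def by blast
  have const: "sgn (poly p x) = sgn (poly p y)" if C: "C \<in> \<C>" "x \<in> C" "y \<in> C" for C x y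
  proof (rule sgn_constant_on_connected[OF \<C>(2)[OF C(1)] _ _ C(2,3)])
    show "poly p z \<noteq> 0" if "z \<in> C" for z
      using that C(1) \<C>(3) by (auto simp: R_def)
  qed (intro continuous_intros)
  have "{x. poly p x > 0} = \<Union>{C \<in> \<C>. C \<subseteq> {x. poly p x > 0}}"
  proof (intro equalityI subsetI)
    fix x assume x: "x \<in> {x. poly p x > 0}"
    then have "x \<in> - R" by (simp add: R_def)
    then obtain C where C: "C \<in> \<C>" "x \<in> C" unfolding \<C>(3) by blast
    have "poly p y > 0" if "y \<in> C" for y
      using const[OF C that] x by (auto simp: sgn_if split: if_splits)
    then show "x \<in> \<Union>{C \<in> \<C>. C \<subseteq> {x. poly p x > 0}}" using C by blast
  qed blast
  then show ?thesis unfolding finite_connected_union_def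
    using \<C>(1,2) by (intro exI[of _ "{C \<in> \<C>. C \<subseteq> {x. poly p x > 0}}"]) simp
qed

text \<open>Along a horizontal line a semialgebraic set is described by sign conditions on polynomials in one
  variable, and finite unions of intervals form a Boolean algebra.\<close>

lemma semialgebraic_line:
  assumes "semialgebraic A"
  shows "finite_connected_union {x. Complex x c \<in> A}"
  using assms
proof induction
  case (pos P)
  have "poly (map_poly (\<lambda>a. poly a c) P) x = poly (poly P [:x:]) c" for x
    by (induction P) (simp_all add: map_poly_pCons)
  then show ?case
    using finite_connected_union_poly_pos[of "map_poly (\<lambda>a. poly a c) P"] by simp
next
  case (Un A B)
  then show ?case by (simp add: Collect_disj_eq finite_connected_union_Un)
next
  case (Compl A)
  then show ?case using finite_connected_union_Compl_real by (simp add: Collect_neg_eq)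
qed

text \<open>The heights outside a finite set fall into intervals over each of which the plane decomposes into
  cells on which all given polynomials have constant sign. The graphs are the real roots of the
  product \<open>F\<close> of all prime factors of the given polynomials. Along one graph each polynomial vanishes
  everywhere or nowhere: if it vanishes at a point, one of its prime factors \<open>p\<close> does, the cofactor
  of \<open>p\<close> in \<open>F\<close> does not because the roots of \<open>F\<close> are simple, and so nearby it is \<open>p\<close> that makes
  \<open>F\<close> vanish on the graph.\<close>

lemma sign_invariant_graph_systems:
  fixes \<P> :: "real poly poly set"
  assumes "finite \<P>" "0 \<notin> \<P>"
  shows "\<exists>B. finite B \<and> (\<forall>I. open I \<longrightarrow> connected I \<longrightarrow> I \<inter> B = {} \<longrightarrow>
    (\<exists>\<Xi>. graph_system I \<Xi> \<and> (\<forall>P\<in>\<P>. \<forall>\<sigma>. \<forall>z\<in>graph_system.cell I \<Xi> \<sigma>. \<forall>w\<in>graph_system.cell I \<Xi> \<sigma>.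
       sgn (eval2 P (Re z) (Im z)) = sgn (eval2 P (Re w) (Im w)))))"
proof -
  define S where "S = (\<Union>P\<in>\<P>. {f. prime f \<and> f dvd P})"
  have finS: "finite S" unfolding S_def
    using assms by (intro finite_UN_I finite_prime_divisors) auto
  have prS: "prime f" if "f \<in> S" for f using that by (simp add: S_def)
  define F where "F = \<Prod>S"
  obtain B where B: "finite B" "\<And>y. y \<notin> B \<Longrightarrow> poly (lead_coeff F) y \<noteq> 0"
    "\<And>y z. y \<notin> B \<Longrightarrow> poly (fibre_poly y F) z = 0 \<Longrightarrow> poly (pderiv (fibre_poly y F)) z \<noteq> 0"
    using squarefree_fibres[OF finS prS] unfolding F_def by blast
  have "\<exists>\<Xi>. graph_system I \<Xi> \<and> (\<forall>P\<in>\<P>. \<forall>\<sigma>. \<forall>z\<in>graph_system.cell I \<Xi> \<sigma>. \<forall>w\<in>graph_system.cell I \<Xi> \<sigma>.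
       sgn (eval2 P (Re z) (Im z)) = sgn (eval2 P (Re w) (Im w)))"
    if I: "open I" "connected I" "I \<inter> B = {}" for I
  proof -
    define X where "X = (\<lambda>y. sorted_list_of_set (real_roots F y))"
    have good: "poly (lead_coeff F) y \<noteq> 0" "finite (real_roots F y)" if "y \<in> I" for y
      using that I(3) B(2)[of y] finite_real_roots[of F y] by auto
    have simple: "poly (pderiv (fibre_poly y F)) z \<noteq> 0" if "y \<in> I" "poly (fibre_poly y F) z = 0" for y z
      using that I(3) B(3)[of y z] by blast
    have card: "card (real_roots F y) = card (real_roots F y')" if "y \<in> I" "y' \<in> I" for y y'
    proof (rule connected_local_const[OF I(2) that], intro ballI)
      fix a assume a: "a \<in> I"
      have "\<forall>\<^sub>F b in at a. card (real_roots F b) = card (real_roots F a)"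
        by (rule real_roots_locally_continuous(1)[OF good(1)[OF a]]) (rule simple[OF a])
      then show "\<forall>\<^sub>F b in at a within I. card (real_roots F a) = card (real_roots F b)"
        unfolding at_within_open[OF a I(1)] by eventually_elim (rule sym)
    qed
    define r where "r = card (real_roots F (SOME y. y \<in> I))"
    have r: "card (real_roots F y) = r" if "y \<in> I" for y
    proof -
      have "(SOME y. y \<in> I) \<in> I" using that by (rule someI)
      from card[OF that this] show ?thesis by (simp only: r_def)
    qed
    define \<xi> where "\<xi> = (\<lambda>i y. X y ! i)"
    define \<Xi> where "\<Xi> = \<xi> ` {..<r}"
    have roots: "real_roots F y = (\<lambda>i. \<xi> i y) ` {..<r}" if "y \<in> I" for y
    proof -
      have "real_roots F y = set (X y)" "length (X y) = r"
        using good(2)[OF that] r[OF that] by (simp_all add: X_def)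
      moreover have "set (X y) = (\<lambda>i. X y ! i) ` {..<length (X y)}"
        by (auto simp: set_conv_nth)
      ultimately show ?thesis by (simp only: \<xi>_def)
    qed
    have lim\<xi>: "(\<xi> i \<longlongrightarrow> \<xi> i y) (at y)" if i: "i < r" and y: "y \<in> I" for i y
      unfolding \<xi>_def X_def
    proof (rule real_roots_locally_continuous(2)[OF good(1)[OF y]])
      show "i < card (real_roots F y)" using i r[OF y] by simp
    qed (rule simple[OF y])
    interpret graph_system I \<Xi>
    proof
      show "connected I" by (rule I(2))
      show "finite \<Xi>" by (simp add: \<Xi>_def)
      show "continuous_on I f" if f: "f \<in> \<Xi>" for f
        unfolding continuous_on_def
      proof
        fix y assume y: "y \<in> I"
        obtain i where "i < r" "f = \<xi> i" using f by (auto simp: \<Xi>_def)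
        then show "(f \<longlongrightarrow> f y) (at y within I)"
          unfolding at_within_open[OF y I(1)] using lim\<xi>[OF _ y] by blast
      qed
      show "f y \<noteq> g y" if fg: "f \<in> \<Xi>" "g \<in> \<Xi>" "f \<noteq> g" and y: "y \<in> I" for f g y
      proof -
        obtain i j where ij: "f = \<xi> i" "g = \<xi> j" "i < r" "j < r"
          using fg by (auto simp: \<Xi>_def)
        have "distinct (X y)" "length (X y) = r"
          using r[OF y] good(2)[OF y] by (simp_all add: X_def)
        moreover have "i \<noteq> j" using ij fg(3) by blast
        ultimately show ?thesis using ij by (simp add: \<xi>_def nth_eq_iff_index_eq)
      qed
    qed
    have F_zero: "eval2 F x y = 0 \<longleftrightarrow> (\<exists>f\<in>\<Xi>. f y = x)" if "y \<in> I" for x y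
      using roots[OF that] unfolding \<Xi>_def real_roots_def by (auto simp: set_eq_iff image_iff)
    have factor: "\<exists>f\<in>S. f dvd P \<and> eval2 f x y = 0" if "P \<in> \<P>" "eval2 P x y = 0" for P x y
      using exists_vanishing_prime_factor[OF that(2)] that(1) assms(2) unfolding S_def by blast
    have P_zero: "\<exists>f\<in>\<Xi>. f y = x" if P: "P \<in> \<P>" "eval2 P x y = 0" and y: "y \<in> I" for P x y
    proof -
      obtain f where f: "f \<in> S" "eval2 f x y = 0" using factor[OF P] by blast
      then have "f dvd F" unfolding F_def using finS by (intro dvd_prodI)
      then obtain G where "F = f * G" unfolding dvd_def by blast
      then have "eval2 F x y = 0" using f(2) by (simp add: eval2_mult)
      then show ?thesis using F_zero[OF y] by blast
    qed
    have graph: "eval2 P (f y) y = 0 \<longleftrightarrow> eval2 P (f y') y' = 0"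
      if P: "P \<in> \<P>" and f: "f \<in> \<Xi>" and yy: "y \<in> I" "y' \<in> I" for P f y y'
    proof (rule connected_local_const[OF I(2) yy, of "\<lambda>y. eval2 P (f y) y = 0"], intro ballI)
      fix a assume a: "a \<in> I"
      have "(f \<longlongrightarrow> f a) (at a)" using lim\<xi>[OF _ a] f by (auto simp: \<Xi>_def)
      then have lim: "((\<lambda>y. eval2 Q (f y) y) \<longlongrightarrow> eval2 Q (f a) a) (at a)" for Q
        by (intro tendsto_eval2 tendsto_ident_at)
      have inI: "\<forall>\<^sub>F b in at a. b \<in> I" using I(1) a by (rule eventually_at_in_open')
      have "\<forall>\<^sub>F b in at a. (eval2 P (f a) a = 0) = (eval2 P (f b) b = 0)"
      proof (cases "eval2 P (f a) a = 0")
        case False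
        then show ?thesis using tendsto_imp_eventually_ne[OF lim[of P] False] by simp
      next
        case True
        obtain p where p: "p \<in> S" "p dvd P" "eval2 p (f a) a = 0" using factor[OF P True] by blast
        define G where "G = \<Prod>(S - {p})"
        have FG: "F = p * G" using prod.remove[OF finS p(1), of "\<lambda>x. x"] by (simp only: F_def G_def)
        have "eval2 G (f a) a \<noteq> 0"
        proof
          assume "eval2 G (f a) a = 0"
          then have "poly (fibre_poly a p) (of_real (f a)) = 0" "poly (fibre_poly a G) (of_real (f a)) = 0"
            using p(3) by (simp_all add: poly_fibre_poly_of_real)
          then show False
            using simple[OF a, of "of_real (f a)"] by (simp add: FG fibre_poly_mult pderiv_mult)
        qed
        from tendsto_imp_eventually_ne[OF lim[of G] this] inI
        have "\<forall>\<^sub>F b in at a. eval2 P (f b) b = 0"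
        proof eventually_elim
          case (elim b)
          have "eval2 F (f b) b = 0" using F_zero[OF elim(2)] f by blast
          then have "eval2 p (f b) b = 0" using elim(1) by (simp add: FG eval2_mult)
          then show ?case using p(2) by (auto simp: dvd_def eval2_mult)
        qed
        then show ?thesis using True by simp
      qed
      then show "\<forall>\<^sub>F b in at a within I. (eval2 P (f a) a = 0) = (eval2 P (f b) b = 0)"
        by (simp only: at_within_open[OF a I(1)])
    qed
    have "sgn (eval2 P (Re z) (Im z)) = sgn (eval2 P (Re w) (Im w))"
      if P: "P \<in> \<P>" and zw: "z \<in> cell \<sigma>" "w \<in> cell \<sigma>" for P \<sigma> z w
    proof (cases "\<exists>v\<in>cell \<sigma>. eval2 P (Re v) (Im v) = 0")
      case True
      then obtain v where v: "v \<in> cell \<sigma>" "eval2 P (Re v) (Im v) = 0" by blast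
      then obtain f where f: "f \<in> \<Xi>" "f (Im v) = Re v"
        using P_zero[OF P v(2)] by (auto simp: cell_def)
      then have "\<sigma> f = 0" using v(1) by (force simp: cell_def)
      then have on: "Re u = f (Im u)" "Im u \<in> I" if "u \<in> cell \<sigma>" for u
        using that f(1) by (auto simp: cell_def sgn_zero_iff)
      have "eval2 P (Re u) (Im u) = 0" if "u \<in> cell \<sigma>" for u
        using graph[OF P f(1) on(2)[OF v(1)] on(2)[OF that]] v on[OF that] f(2) by simp
      then show ?thesis using zw by simp
    next
      case False
      have "continuous_on (cell \<sigma>) (\<lambda>v. eval2 P (Re v) (Im v))"
        by (intro continuous_on_eval2 continuous_on_Re continuous_on_Im continuous_on_id)
      from sgn_constant_on_connected[OF connected_cell this _ zw] False show ?thesis by blast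
    qed
    then show ?thesis using graph_system_axioms by blast
  qed
  then show ?thesis using B(1) by blast
qed

lemma convex_line_interval:
  assumes "convex K"
  shows "is_interval {x. Complex x c \<in> K}"
  unfolding is_interval_convex_1
proof (rule convexI)
  fix x y u v :: real
  assume *: "x \<in> {x. Complex x c \<in> K}" "y \<in> {x. Complex x c \<in> K}" "0 \<le> u" "0 \<le> v" "u + v = 1"
  have "c = (u + v) * c" using * by simp
  then have "Complex (u *\<^sub>R x + v *\<^sub>R y) c = u *\<^sub>R Complex x c + v *\<^sub>R Complex y c"
    by (simp add: complex_eq_iff algebra_simps)
  then show "u *\<^sub>R x + v *\<^sub>R y \<in> {x. Complex x c \<in> K}"
    using convexD[OF assms, of "Complex x c" "Complex y c" u v] * by simp
qed

text \<open>The plane is cut into finitely many open strips, over which the set is a union of cells,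
  and finitely many horizontal lines. In a strip the closure is again a union of
  cells. On an exceptional line the closure is a finite union of intervals, since the set is a finite
  union of cells and of intervals on exceptional lines, and the closure of each of these pieces
  meets the line in an interval. Both descriptions pass to Boolean combinations of the set and its
  closure.\<close>

proposition semialgebraic_finite_components:
  assumes "semialgebraic \<Omega>"
  shows "finite (components \<Omega>)" "finite (components (closure \<Omega> - \<Omega>))" "finite (components (- closure \<Omega>))"
proof -
  obtain \<P> where \<P>: "finite \<P>" "0 \<notin> \<P>"
    "\<forall>z w. (\<forall>P\<in>\<P>. sgn (eval2 P (Re z) (Im z)) = sgn (eval2 P (Re w) (Im w))) \<longrightarrow> (z \<in> \<Omega> \<longleftrightarrow> w \<in> \<Omega>)"
    using semialgebraic_sign_determined[OF assms] by (elim exE conjE)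
  obtain B where B: "finite B" and systems: "\<forall>I. open I \<longrightarrow> connected I \<longrightarrow> I \<inter> B = {} \<longrightarrow>
      (\<exists>\<Xi>. graph_system I \<Xi> \<and> (\<forall>P\<in>\<P>. \<forall>\<sigma>. \<forall>z\<in>graph_system.cell I \<Xi> \<sigma>. \<forall>w\<in>graph_system.cell I \<Xi> \<sigma>.
       sgn (eval2 P (Re z) (Im z)) = sgn (eval2 P (Re w) (Im w))))"
    using sign_invariant_graph_systems[OF \<P>(1,2)] by (elim exE conjE)
  define \<I> where "\<I> = components (- B)"
  have "finite_connected_union (\<Union>b\<in>B. {b})"
    using B by (intro finite_connected_union_UN finite_connected_union_connected) auto
  then have fin\<I>: "finite \<I>"
    unfolding \<I>_def by (intro finite_components_if_finite_connected_union finite_connected_union_Compl_real) simp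
  have \<I>: "open I" "connected I" "I \<inter> B = {}" if I: "I \<in> \<I>" for I
  proof -
    have "open (- B)" using B by (simp add: finite_imp_closed open_Compl)
    then show "open I" using I unfolding \<I>_def by (rule open_components)
    show "connected I" using I unfolding \<I>_def by (rule in_components_connected)
    show "I \<inter> B = {}" using in_components_subset[OF I[unfolded \<I>_def]] by blast
  qed
  have "\<forall>I\<in>\<I>. \<exists>\<Xi>. graph_system I \<Xi> \<and> graph_system.saturated I \<Xi> \<Omega>"
  proof
    fix I assume I: "I \<in> \<I>"
    obtain \<Xi> where \<Xi>: "graph_system I \<Xi>" "\<forall>P\<in>\<P>. \<forall>\<sigma>. \<forall>z\<in>graph_system.cell I \<Xi> \<sigma>. \<forall>w\<in>graph_system.cell I \<Xi> \<sigma>.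
       sgn (eval2 P (Re z) (Im z)) = sgn (eval2 P (Re w) (Im w))"
      using systems[rule_format, OF \<I>[OF I]] by (elim exE conjE)
    interpret graph_system I \<Xi> by (rule \<Xi>(1))
    have "saturated \<Omega>"
      unfolding saturated_def
    proof (intro allI impI)
      fix z w assume zw: "Im z \<in> I" "Im w \<in> I"
        "\<forall>f\<in>\<Xi>. sgn (Re z - f (Im z)) = sgn (Re w - f (Im w))" "z \<in> \<Omega>"
      let ?\<sigma> = "\<lambda>f. sgn (Re z - f (Im z))"
      have "z \<in> cell ?\<sigma>" "w \<in> cell ?\<sigma>" using zw by (simp_all add: cell_def)
      then have "\<forall>P\<in>\<P>. sgn (eval2 P (Re z) (Im z)) = sgn (eval2 P (Re w) (Im w))"
        using \<Xi>(2) by blast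
      then show "w \<in> \<Omega>" using \<P>(3) zw(4) by blast
    qed
    then show "\<exists>\<Xi>. graph_system I \<Xi> \<and> graph_system.saturated I \<Xi> \<Omega>" using \<Xi>(1) by blast
  qed
  from bchoice[OF this] obtain \<Xi> where \<Xi>: "\<And>I. I \<in> \<I> \<Longrightarrow> graph_system I (\<Xi> I)"
    "\<And>I. I \<in> \<I> \<Longrightarrow> graph_system.saturated I (\<Xi> I) \<Omega>" by blast
  have split: "S = (\<Union>I\<in>\<I>. S \<inter> {z. Im z \<in> I}) \<union> (\<Union>c\<in>B. (\<lambda>x. Complex x c) ` {x. Complex x c \<in> S})" for S
  proof (intro equalityI subsetI)
    fix z assume z: "z \<in> S"
    show "z \<in> (\<Union>I\<in>\<I>. S \<inter> {z. Im z \<in> I}) \<union> (\<Union>c\<in>B. (\<lambda>x. Complex x c) ` {x. Complex x c \<in> S})"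
    proof (cases "Im z \<in> B")
      case True
      then have "z \<in> (\<Union>c\<in>B. (\<lambda>x. Complex x c) ` {x. Complex x c \<in> S})"
        using z by (intro UN_I[OF True] image_eqI[of _ _ "Re z"]) simp_all
      then show ?thesis by blast
    next
      case False
      then have "Im z \<in> \<Union>\<I>" using Union_components[of "- B"] by (simp add: \<I>_def)
      then show ?thesis using z by blast
    qed
  qed auto
  have line\<Omega>: "finite_connected_union {x. Complex x c \<in> \<Omega>}" for c
    by (rule semialgebraic_line[OF assms])
  have line_closure: "finite_connected_union {x. Complex x c \<in> closure \<Omega>}" for c
  proof -
    define Q where "Q = (\<lambda>S. finite_connected_union {x. Complex x c \<in> closure S})"
    have Q_Union: "Q (\<Union>\<C>)" if \<C>: "finite \<C>" "\<And>C. C \<in> \<C> \<Longrightarrow> Q C" for \<C>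
    proof -
      have "{x. Complex x c \<in> closure (\<Union>\<C>)} = (\<Union>C\<in>\<C>. {x. Complex x c \<in> closure C})"
        by (auto simp: closure_Union_finite[OF \<C>(1)])
      then show ?thesis unfolding Q_def
        using \<C> by (simp add: Q_def finite_connected_union_UN)
    qed
    have Q_strip: "Q (\<Omega> \<inter> {z. Im z \<in> I})" if I: "I \<in> \<I>" for I
    proof -
      interpret graph_system I "\<Xi> I" by (rule \<Xi>(1)[OF I])
      have "Q C" if C: "C \<in> range cell" for C
      proof -
        obtain \<sigma> where \<sigma>: "C = cell \<sigma>" using C by blast
        show ?thesis unfolding Q_def \<sigma>
          using interval_cluster_set[of c \<sigma>] unfolding is_interval_connected_1 by (rule finite_connected_union_connected)
      qed
      then show ?thesis
        unfolding saturated_strip[OF \<Xi>(2)[OF I]] using finite_cells by (intro Q_Union) auto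
    qed
    have Q_line: "Q ((\<lambda>x. Complex x b) ` {x. Complex x b \<in> \<Omega>})" for b
    proof -
      obtain \<C> where \<C>: "finite \<C>" "\<And>C. C \<in> \<C> \<Longrightarrow> connected C" "{x. Complex x b \<in> \<Omega>} = \<Union>\<C>"
        using line\<Omega>[of b] unfolding finite_connected_union_def by blast
      have "Q ((\<lambda>x. Complex x b) ` C)" if C: "C \<in> \<C>" for C
      proof -
        have "convex C" using \<C>(2)[OF C] is_interval_connected_1 is_interval_convex_1 by blast
        moreover have "(\<lambda>x. Complex x b) ` C = (\<lambda>x. Complex 0 b + of_real x) ` C"
          by (intro image_cong) (auto simp: complex_eq_iff)
        moreover have "(\<lambda>x. Complex 0 b + of_real x) ` C = (+) (Complex 0 b) ` of_real ` C"
          by (simp add: image_image)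
        moreover have "linear (of_real :: real \<Rightarrow> complex)"
          by (intro linearI) (simp_all add: scaleR_conv_of_real)
        ultimately have "convex ((\<lambda>x. Complex x b) ` C)"
          by (simp only: convex_translation convex_linear_image)
        then have "is_interval {x. Complex x c \<in> closure ((\<lambda>x. Complex x b) ` C)}"
          by (intro convex_line_interval convex_closure)
        then show ?thesis unfolding Q_def
          unfolding is_interval_connected_1 by (rule finite_connected_union_connected)
      qed
      then have "Q (\<Union>((`) (\<lambda>x. Complex x b) ` \<C>))" using \<C>(1) by (intro Q_Union) auto
      then show ?thesis unfolding \<C>(3) by (simp add: image_Union)
    qed
    have "Q (\<Union>((\<lambda>I. \<Omega> \<inter> {z. Im z \<in> I}) ` \<I> \<union> (\<lambda>b. (\<lambda>x. Complex x b) ` {x. Complex x b \<in> \<Omega>}) ` B))"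
      using fin\<I> B Q_strip Q_line by (intro Q_Union) auto
    then have "Q \<Omega>" by (subst split) simp
    then show ?thesis by (simp add: Q_def)
  qed
  have fin: "finite (components S)"
    if sat: "\<And>I. I \<in> \<I> \<Longrightarrow> graph_system.saturated I (\<Xi> I) S"
      and line: "\<And>c. finite_connected_union {x. Complex x c \<in> S}" for S
  proof (rule finite_components_if_finite_connected_union, subst split,
      intro finite_connected_union_Un finite_connected_union_UN fin\<I> B)
    show "finite_connected_union (S \<inter> {z. Im z \<in> I})" if "I \<in> \<I>" for I
      by (rule graph_system.saturated_strip_finite_connected_union[OF \<Xi>(1)[OF that] sat[OF that]])
    show "finite_connected_union ((\<lambda>x. Complex x c) ` {x. Complex x c \<in> S})" for c
      by (intro finite_connected_union_image line continuous_intros)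
  qed
  have sat_closure: "graph_system.saturated I (\<Xi> I) (closure \<Omega>)" if "I \<in> \<I>" for I
    by (rule graph_system.saturated_closure[OF \<Xi>(1)[OF that] \<I>(1)[OF that] \<Xi>(2)[OF that]])
  show "finite (components \<Omega>)"
    by (intro fin \<Xi>(2) line\<Omega>)
  show "finite (components (- closure \<Omega>))"
  proof (rule fin)
    show "graph_system.saturated I (\<Xi> I) (- closure \<Omega>)" if "I \<in> \<I>" for I
      by (rule graph_system.saturated_Compl[OF \<Xi>(1)[OF that] sat_closure[OF that]])
    show "finite_connected_union {x. Complex x c \<in> - closure \<Omega>}" for c
      using finite_connected_union_Compl_real[OF line_closure[of c]] by (simp add: Collect_neg_eq)
  qed
  show "finite (components (closure \<Omega> - \<Omega>))"
  proof (rule fin)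
    show "graph_system.saturated I (\<Xi> I) (closure \<Omega> - \<Omega>)" if "I \<in> \<I>" for I
      unfolding Diff_eq
      by (intro graph_system.saturated_Int graph_system.saturated_Compl \<Xi> sat_closure that)
    show "finite_connected_union {x. Complex x c \<in> closure \<Omega> - \<Omega>}" for c
      using finite_connected_union_Int_real[OF line_closure[of c] finite_connected_union_Compl_real[OF line\<Omega>[of c]]]
      by (simp add: Collect_conj_eq Collect_neg_eq Diff_eq)
  qed
qed

section \<open>Components of a root stratum\<close>

lemma openin_component_if_finite:
  assumes "finite (components S)" "K \<in> components S"
  shows "openin (top_of_set S) K"
proof -
  have "S - K = \<Union>(components S - {K})"
  proof (intro equalityI subsetI)
    fix x assume "x \<in> \<Union>(components S - {K})"
    then obtain K' where K': "K' \<in> components S" "K' \<noteq> K" "x \<in> K'" by blast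
    then have "x \<notin> K" using components_nonoverlap[OF K'(1) assms(2)] by blast
    moreover have "x \<in> S" using K' in_components_subset by blast
    ultimately show "x \<in> S - K" by blast
  next
    fix x assume "x \<in> S - K"
    then show "x \<in> \<Union>(components S - {K})" using Union_components[of S] by blast
  qed
  moreover have "closedin (top_of_set S) (\<Union>(components S - {K}))"
    using assms(1) by (intro closedin_Union) (auto intro: closedin_component)
  ultimately have "closedin (top_of_set S) (S - K)" by simp
  moreover have "K \<subseteq> S" using assms(2) by (rule in_components_subset)
  ultimately show ?thesis by (simp add: openin_closedin_eq)
qed

text \<open>With finitely many components, each component is open in the set.\<close>

lemma component_locally_constant:
  assumes "finite (components S)" "z \<in> S"
  shows "\<forall>\<^sub>F w in nhds z. w \<in> S \<longrightarrow> connected_component_set S w = connected_component_set S z"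
proof -
  let ?K = "connected_component_set S z"
  have "?K \<in> components S" using assms(2) by (rule componentsI)
  then obtain V where V: "open V" "?K = S \<inter> V"
    using openin_component_if_finite[OF assms(1)] by (auto simp: openin_open)
  have "z \<in> ?K" using assms(2) by simp
  then have "z \<in> V" using V(2) by blast
  then have "\<forall>\<^sub>F w in nhds z. w \<in> V" using V(1) by (intro eventually_nhds_in_open)
  then show ?thesis
  proof eventually_elim
    case (elim w)
    show ?case
    proof
      assume "w \<in> S"
      then have "w \<in> ?K" using V(2) elim by blast
      then show "connected_component_set S w = ?K" by (simp add: connected_component_eq)
    qed
  qed
qed

text \<open>A root is labelled by its component in whichever of the open exterior, \<open>\<Omega>\<close>, and the border
  contains it, and these three sets have weights \<open>0\<close>, \<open>1\<close>, and \<open>2\<close>. A point of the exterior stays there under small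
  motions, and a point of \<open>\<Omega>\<close> can only stay or move to the exterior because \<open>\<Omega>\<close> is open in its
  closure; so the weight never increases. The stratum consists of the polynomials with total
  weight \<open>k + 2 * l\<close> whose labels are distributed over the three sets as \<open>k\<close>, \<open>l\<close> and \<open>m\<close>, and a
  label multiset is a triple of multisets of components.\<close>

proposition root_stratum_components:
  fixes \<Omega> :: "complex set" and k l m :: nat
  assumes fin: "finite (components \<Omega>)" "finite (components (closure \<Omega> - \<Omega>))" "finite (components (- closure \<Omega>))"
    and op: "openin (top_of_set (closure \<Omega>)) \<Omega>"
  defines "X \<equiv> subtopology (poly_topology (k + l + m)) (root_stratum \<Omega> k l m)"
  shows "finite (connected_components_of X)"
    and "card (connected_components_of X) =
      ((card (components \<Omega>) + k - 1) choose k) *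
      ((card (components (closure \<Omega> - \<Omega>)) + l - 1) choose l) *
      ((card (components (- closure \<Omega>)) + m - 1) choose m)"
proof -
  define \<A> \<B> \<C> where "\<A> = components \<Omega>" and "\<B> = components (closure \<Omega> - \<Omega>)" and "\<C> = components (- closure \<Omega>)"
  define part where "part z = (if z \<in> \<Omega> then \<Omega> else if z \<in> closure \<Omega> then closure \<Omega> - \<Omega> else - closure \<Omega>)" for z
  define lab where "lab z = connected_component_set (part z) z" for z
  define \<tau> :: "complex set \<Rightarrow> nat" where "\<tau> D = (if D \<in> \<A> then 1 else if D \<in> \<B> then 2 else 0)" for D
  have sub: "\<Omega> \<subseteq> closure \<Omega>" by (rule closure_subset)
  have in_part: "z \<in> part z" for z by (simp add: part_def)
  have in_lab: "z \<in> lab z" for z using in_part by (simp add: lab_def)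
  have lab_comp: "lab z \<in> components (part z)" for z
    unfolding lab_def using in_part by (rule componentsI)
  have lab_cases: "lab z \<in> \<A> \<longleftrightarrow> z \<in> \<Omega>" "lab z \<in> \<B> \<longleftrightarrow> z \<in> closure \<Omega> - \<Omega>" "lab z \<in> \<C> \<longleftrightarrow> z \<in> - closure \<Omega>" for z
  proof -
    have "lab z \<in> components S \<longleftrightarrow> z \<in> S" if "S \<in> {\<Omega>, closure \<Omega> - \<Omega>, - closure \<Omega>}" for S
    proof
      assume "lab z \<in> components S"
      then have "lab z \<subseteq> S" by (rule in_components_subset)
      then show "z \<in> S" using in_lab[of z] by blast
    next
      assume "z \<in> S"
      then have "part z = S" using that sub by (auto simp: part_def)
      then show "lab z \<in> components S" using lab_comp[of z] by simp
    qed
    then show "lab z \<in> \<A> \<longleftrightarrow> z \<in> \<Omega>" "lab z \<in> \<B> \<longleftrightarrow> z \<in> closure \<Omega> - \<Omega>" "lab z \<in> \<C> \<longleftrightarrow> z \<in> - closure \<Omega>"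
      by (simp_all add: \<A>_def \<B>_def \<C>_def)
  qed
  have in_components_cases: "\<exists>S\<in>{\<Omega>, closure \<Omega> - \<Omega>, - closure \<Omega>}. D \<in> components S"
    if "D \<in> \<A> \<union> \<B> \<union> \<C>" for D
    using that unfolding \<A>_def \<B>_def \<C>_def by blast
  have lab_eq: "lab w = D" if "D \<in> \<A> \<union> \<B> \<union> \<C>" "w \<in> D" for D w
  proof -
    from in_components_cases[OF that(1)]
    obtain S where S: "S \<in> {\<Omega>, closure \<Omega> - \<Omega>, - closure \<Omega>}" "D \<in> components S" by blast
    then have "D \<subseteq> S" by (intro in_components_subset)
    then have "w \<in> S" using that(2) by blast
    then have "part w = S" using S(1) sub by (auto simp: part_def)
    moreover have "connected_component_set S w = D"
    proof -
      obtain x where "D = connected_component_set S x" using S(2) unfolding components_iff by blast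
      then show ?thesis using connected_component_eq[of w S x] that(2) by simp
    qed
    ultimately show ?thesis by (simp add: lab_def)
  qed
  have range_lab: "range lab = \<A> \<union> \<B> \<union> \<C>"
  proof (intro equalityI subsetI)
    fix D assume "D \<in> range lab"
    then show "D \<in> \<A> \<union> \<B> \<union> \<C>" using lab_cases by blast
  next
    fix D assume D: "D \<in> \<A> \<union> \<B> \<union> \<C>"
    then have "D \<noteq> {}" using in_components_cases in_components_nonempty by blast
    then obtain w where "w \<in> D" by blast
    then show "D \<in> range lab" using lab_eq[OF D] by blast
  qed
  have disj: "\<A> \<inter> \<B> = {}" "\<A> \<inter> \<C> = {}" "\<B> \<inter> \<C> = {}"
  proof -
    have "False" if "D \<in> components S" "D \<in> components T" "S \<inter> T = {}" for D :: "complex set" and S T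
      using in_components_nonempty[OF that(1)] in_components_subset[OF that(1)]
        in_components_subset[OF that(2)] that(3) by blast
    then show "\<A> \<inter> \<B> = {}" "\<A> \<inter> \<C> = {}" "\<B> \<inter> \<C> = {}"
      unfolding \<A>_def \<B>_def \<C>_def using sub by blast+
  qed
  define M where "M = (\<lambda>(\<alpha>, \<beta>, \<gamma>). \<alpha> + \<beta> + \<gamma>) `
      (multisets_of_size \<A> k \<times> multisets_of_size \<B> l \<times> multisets_of_size \<C> m)"
  have filters: "filter_mset (\<lambda>D. D \<in> \<A>) (\<alpha> + \<beta> + \<gamma>) = \<alpha>" "filter_mset (\<lambda>D. D \<in> \<B>) (\<alpha> + \<beta> + \<gamma>) = \<beta>"
      "filter_mset (\<lambda>D. D \<in> \<C>) (\<alpha> + \<beta> + \<gamma>) = \<gamma>"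
    if "set_mset \<alpha> \<subseteq> \<A>" "set_mset \<beta> \<subseteq> \<B>" "set_mset \<gamma> \<subseteq> \<C>" for \<alpha> \<beta> \<gamma>
  proof -
    have all: "filter_mset (\<lambda>D. D \<in> T) \<mu> = \<mu>" if "set_mset \<mu> \<subseteq> T" for \<mu> and T :: "complex set set"
      using that by (intro filter_mset_eq_conv[THEN iffD2]) auto
    have none: "filter_mset (\<lambda>D. D \<in> T) \<mu> = {#}" if "set_mset \<mu> \<subseteq> T'" "T' \<inter> T = {}" for \<mu> and T T' :: "complex set set"
      unfolding filter_mset_eq_mempty_iff using that by blast
    show "filter_mset (\<lambda>D. D \<in> \<A>) (\<alpha> + \<beta> + \<gamma>) = \<alpha>"
      using all[of \<alpha> \<A>] none[of \<beta> \<B> \<A>] none[of \<gamma> \<C> \<A>] that disj by (simp add: Int_commute)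
    show "filter_mset (\<lambda>D. D \<in> \<B>) (\<alpha> + \<beta> + \<gamma>) = \<beta>"
      using all[of \<beta> \<B>] none[of \<alpha> \<A> \<B>] none[of \<gamma> \<C> \<B>] that disj by (simp add: Int_commute)
    show "filter_mset (\<lambda>D. D \<in> \<C>) (\<alpha> + \<beta> + \<gamma>) = \<gamma>"
      using all[of \<gamma> \<C>] none[of \<alpha> \<A> \<C>] none[of \<beta> \<B> \<C>] that disj by (simp add: Int_commute)
  qed
  have inj: "inj_on (\<lambda>(\<alpha>, \<beta>, \<gamma>). \<alpha> + \<beta> + \<gamma>)
      (multisets_of_size \<A> k \<times> multisets_of_size \<B> l \<times> multisets_of_size \<C> m)"
  proof (rule inj_on_inverseI)
    fix t assume "t \<in> multisets_of_size \<A> k \<times> multisets_of_size \<B> l \<times> multisets_of_size \<C> m"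
    then obtain \<alpha> \<beta> \<gamma> where t: "t = (\<alpha>, \<beta>, \<gamma>)" "set_mset \<alpha> \<subseteq> \<A>" "set_mset \<beta> \<subseteq> \<B>" "set_mset \<gamma> \<subseteq> \<C>"
      unfolding multisets_of_size_def by blast
    let ?g = "\<lambda>\<nu>. (filter_mset (\<lambda>D. D \<in> \<A>) \<nu>, filter_mset (\<lambda>D. D \<in> \<B>) \<nu>, filter_mset (\<lambda>D. D \<in> \<C>) \<nu>)"
    show "?g ((\<lambda>(\<alpha>, \<beta>, \<gamma>). \<alpha> + \<beta> + \<gamma>) t) = t"
      unfolding t(1) prod.case filters[OF t(2-4)] ..
  qed
  have fin': "finite \<A>" "finite \<B>" "finite \<C>" using fin by (simp_all add: \<A>_def \<B>_def \<C>_def)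
  have cardM: "card M = ((card \<A> + k - 1) choose k) * ((card \<B> + l - 1) choose l) * ((card \<C> + m - 1) choose m)"
    unfolding M_def card_image[OF inj] using fin' by (simp add: card_cartesian_product card_multisets_of_size)
  have finM: "finite M" unfolding M_def using fin' by (intro finite_imageI finite_cartesian_product finite_multisets_of_size)
  have M_E: "\<exists>\<alpha> \<beta> \<gamma>. \<nu> = \<alpha> + \<beta> + \<gamma> \<and> set_mset \<alpha> \<subseteq> \<A> \<and> set_mset \<beta> \<subseteq> \<B> \<and> set_mset \<gamma> \<subseteq> \<C> \<and>
      size \<alpha> = k \<and> size \<beta> = l \<and> size \<gamma> = m" if "\<nu> \<in> M" for \<nu>
    using that unfolding M_def multisets_of_size_def by auto
  have M1: "set_mset \<nu> \<subseteq> range lab" if "\<nu> \<in> M" for \<nu>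
    using M_E[OF that] unfolding range_lab by auto
  have M2: "size \<nu> = k + l + m" if "\<nu> \<in> M" for \<nu>
    using M_E[OF that] by auto
  have M3: "(\<Sum>D\<in>#\<nu>. \<tau> D) = k + 2 * l" if \<nu>: "\<nu> \<in> M" for \<nu>
  proof -
    obtain \<alpha> \<beta> \<gamma> where *: "\<nu> = \<alpha> + \<beta> + \<gamma>" "set_mset \<alpha> \<subseteq> \<A>" "set_mset \<beta> \<subseteq> \<B>" "set_mset \<gamma> \<subseteq> \<C>"
      "size \<alpha> = k" "size \<beta> = l" using M_E[OF \<nu>] by blast
    have "image_mset \<tau> \<alpha> = image_mset (\<lambda>_. 1) \<alpha>"
      using *(2) by (intro image_mset_cong) (auto simp: \<tau>_def)
    moreover have "image_mset \<tau> \<beta> = image_mset (\<lambda>_. 2) \<beta>"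
      using *(3) disj by (intro image_mset_cong) (auto simp: \<tau>_def)
    moreover have "image_mset \<tau> \<gamma> = image_mset (\<lambda>_. 0) \<gamma>"
      using *(4) disj by (intro image_mset_cong) (auto simp: \<tau>_def)
    ultimately show ?thesis using * by (simp add: sum_mset_constant)
  qed
  have conn: "connected (lab -` {D})" if D: "D \<in> range lab" for D
  proof -
    have "lab -` {D} = D"
      using lab_eq[of D] in_lab D unfolding range_lab by auto
    moreover have "connected D"
      using in_components_cases[of D] D in_components_connected unfolding range_lab by blast
    ultimately show ?thesis by simp
  qed
  have \<tau>lab: "\<tau> (lab z) = (if z \<in> \<Omega> then 1 else if z \<in> closure \<Omega> then 2 else 0)" for z
    by (simp add: \<tau>_def lab_cases)
  have loc: "\<forall>\<^sub>F w in nhds z. \<tau> (lab w) \<le> \<tau> (lab z) \<and> (\<tau> (lab w) = \<tau> (lab z) \<longrightarrow> lab w = lab z)" for z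
  proof -
    have "finite (components (part z))" using fin by (simp add: part_def)
    then have near: "\<forall>\<^sub>F w in nhds z. w \<in> part z \<longrightarrow> connected_component_set (part z) w = lab z"
      using component_locally_constant[OF _ in_part] by (simp add: lab_def)
    have "\<forall>\<^sub>F w in nhds z. \<tau> (lab w) \<le> \<tau> (lab z)"
    proof -
      obtain U where U: "open U" "\<Omega> = closure \<Omega> \<inter> U" using op by (auto simp: openin_open)
      consider "z \<in> \<Omega>" | "z \<notin> \<Omega>" "z \<in> closure \<Omega>" | "z \<in> - closure \<Omega>" using sub by blast
      then show ?thesis
      proof cases
        case 1
        then have "\<forall>\<^sub>F w in nhds z. w \<in> U" using U by (intro eventually_nhds_in_open) auto
        then show ?thesis
        proof eventually_elim
          case (elim w)
          then have "w \<in> closure \<Omega> \<Longrightarrow> w \<in> \<Omega>" using U(2) by blast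
          then show ?case using 1 by (auto simp: \<tau>lab)
        qed
      next
        case 2
        then show ?thesis by (simp add: \<tau>lab)
      next
        case 3
        then have "\<forall>\<^sub>F w in nhds z. w \<in> - closure \<Omega>" by (intro eventually_nhds_in_open) auto
        then show ?thesis
        proof eventually_elim
          case (elim w)
          then have "w \<notin> \<Omega>" "w \<notin> closure \<Omega>" using sub by auto
          then show ?case by (simp add: \<tau>lab)
        qed
      qed
    qed
    with near show ?thesis
    proof eventually_elim
      case (elim w)
      have "lab w = lab z" if "\<tau> (lab w) = \<tau> (lab z)"
      proof -
        have "part w = part z" using that sub unfolding \<tau>lab part_def by (auto split: if_splits)
        then show ?thesis using elim(1) in_part[of w] by (simp add: lab_def)
      qed
      then show ?case using elim(2) by blast
    qed
  qed
  have stratum: "root_stratum \<Omega> k l m = (\<Union>\<nu>\<in>M. labelled_roots (k + l + m) lab \<nu>)"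
  proof (intro equalityI subsetI)
    fix p assume p: "p \<in> root_stratum \<Omega> k l m"
    define \<alpha> \<beta> \<gamma> where "\<alpha> = image_mset lab (filter_mset (\<lambda>z. z \<in> \<Omega>) (proots p))"
      and "\<beta> = image_mset lab (filter_mset (\<lambda>z. z \<in> closure \<Omega> - \<Omega>) (proots p))"
      and "\<gamma> = image_mset lab (filter_mset (\<lambda>z. z \<in> - closure \<Omega>) (proots p))"
    have "filter_mset (\<lambda>z. z \<in> \<Omega>) N + filter_mset (\<lambda>z. z \<in> closure \<Omega> - \<Omega>) N
        + filter_mset (\<lambda>z. z \<in> - closure \<Omega>) N = N" for N
      using sub by (intro multiset_eqI) auto
    then have "image_mset lab (proots p) = \<alpha> + \<beta> + \<gamma>"
      unfolding \<alpha>_def \<beta>_def \<gamma>_def image_mset_union[symmetric] by simp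
    moreover have "\<alpha> \<in> multisets_of_size \<A> k" "\<beta> \<in> multisets_of_size \<B> l" "\<gamma> \<in> multisets_of_size \<C> m"
      using p by (auto simp: multisets_of_size_def root_stratum_def \<alpha>_def \<beta>_def \<gamma>_def lab_cases)
    ultimately have "image_mset lab (proots p) \<in> M" unfolding M_def by force
    then show "p \<in> (\<Union>\<nu>\<in>M. labelled_roots (k + l + m) lab \<nu>)"
      using p by (auto simp: labelled_roots_def root_stratum_def)
  next
    fix p assume "p \<in> (\<Union>\<nu>\<in>M. labelled_roots (k + l + m) lab \<nu>)"
    then have p: "p \<noteq> 0" "degree p = k + l + m" "image_mset lab (proots p) \<in> M"
      by (auto simp: labelled_roots_def)
    obtain \<alpha> \<beta> \<gamma> where *: "image_mset lab (proots p) = \<alpha> + \<beta> + \<gamma>"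
      "set_mset \<alpha> \<subseteq> \<A>" "set_mset \<beta> \<subseteq> \<B>" "set_mset \<gamma> \<subseteq> \<C>" "size \<alpha> = k" "size \<beta> = l" "size \<gamma> = m"
      using M_E[OF p(3)] by blast
    have size: "size (filter_mset (\<lambda>z. lab z \<in> T) (proots p)) = size (filter_mset (\<lambda>D. D \<in> T) (\<alpha> + \<beta> + \<gamma>))" for T
      unfolding *(1)[symmetric] by (simp add: filter_mset_image_mset o_def)
    show "p \<in> root_stratum \<Omega> k l m"
      using p size[of \<A>] size[of \<B>] size[of \<C>] *(5-7) unfolding filters[OF *(2-4)] lab_cases root_stratum_def
      by simp
  qed
  have comps: "connected_components_of X = labelled_roots (k + l + m) lab ` M"
    unfolding X_def stratum
    by (rule components_of_labelled_strata(1)[where \<tau> = \<tau> and t = "k + 2 * l"]) (fact conn loc M1 M2 M3)+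
  show "finite (connected_components_of X)" unfolding comps using finM by simp
  have "inj_on (labelled_roots (k + l + m) lab) M"
    by (rule components_of_labelled_strata(2)[where \<tau> = \<tau> and t = "k + 2 * l"]) (fact conn loc M1 M2 M3)+
  then show "card (connected_components_of X) =
      ((card (components \<Omega>) + k - 1) choose k) *
      ((card (components (closure \<Omega> - \<Omega>)) + l - 1) choose l) *
      ((card (components (- closure \<Omega>)) + m - 1) choose m)"
    unfolding comps using cardM by (simp add: card_image \<A>_def \<B>_def \<C>_def)
qed

theorem theorem2:
  fixes \<Omega> :: "complex set" and b\<^sub>s b\<^sub>s\<^sub>s b\<^sub>u\<^sub>n k l m :: nat
  assumes "semialgebraic \<Omega>"
    and "openin (top_of_set (closure \<Omega>)) \<Omega>"
    and "b\<^sub>s = card (components \<Omega>)"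
    and "b\<^sub>s\<^sub>s = card (components (closure \<Omega> - \<Omega>))"
    and "b\<^sub>u\<^sub>n = card (components (- closure \<Omega>))"
  defines "X \<equiv> subtopology (poly_topology (k + l + m)) (root_stratum \<Omega> k l m)"
  shows "finite (connected_components_of X) \<and>
    card (connected_components_of X) =
      ((b\<^sub>s + k - 1) choose k) * ((b\<^sub>s\<^sub>s + l - 1) choose l) * ((b\<^sub>u\<^sub>n + m - 1) choose m)"
  unfolding X_def assms(3-5)
  using root_stratum_components[OF semialgebraic_finite_components[OF assms(1)] assms(2), of k l m] by blast

end
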